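(* Let $n \ge 1$. There exist $k^\# \in \mathbb{N}$ and $C_1 > 0$, depending only on the dimension $n$, such that the following holds. Let $E \subset \mathbb{R}^n$ be compact, let $M > \eta > 0$, and let $f: E \to \mathbb{R}$. Suppose that for every $S \subset E$ with $\#S \le k^\#$ there exists an $\eta$-strongly convex function $F^S \in C^{1,1}_c(\mathbb{R}^n)$ satisfying $F^S|_S = f|_S$ and $\mathrm{Lip}(\nabla F^S) \le M$. Then for any $p, q \in (1,\infty)$ with $\frac1p + \frac1q = 1$, there exists an $\frac{\eta}{p^2}$-strongly convex function $F \in C^{1,1}_c(\mathbb{R}^n)$ satisfying $F|_E = f|_E$ and $\mathrm{Lip}(\nabla F) \le C_1 q^2 M^2/\eta$.
   Context: $|\cdot|$ is the Euclidean norm. $C^{1,1}_c(\mathbb{R}^n)$ denotes the set of convex, differentiable functions $F:\mathbb{R}^n\to\mathbb{R}$ whose gradient is (globally) Lipschitz continuous (the subscript $c$ stands for "convex"). For a map $G:\mathbb{R}^n \to \mathbb{R}^d$, $\mathrm{Lip}(G) = \sup_{x \ne y} |G(x)-G(y)|/|x-y|$. For $\eta \ge 0$, $F$ is $\eta$-strongly convex if $x \mapsto F(x) - \frac{\eta}{2}|x|^2$ is convex. $\#S$ is the cardinality of $S$. *)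

theory Defs
  imports "HOL-Analysis.Analysis"
begin

text \<open>Only meaningful at points where \<open>F\<close> is differentiable.\<close>

definition grad :: "('a::euclidean_space \<Rightarrow> real) \<Rightarrow> 'a \<Rightarrow> 'a"
  where "grad F x = (THE D. GDERIV F x :> D)"

lemma grad_eqI:
  assumes "GDERIV F x :> D"
  shows "grad F x = D"
  unfolding grad_def
proof (rule the_equality)
  fix D' assume "GDERIV F x :> D'"
  then have "(\<lambda>h. inner h D') = (\<lambda>h. inner h D)"
    using assms unfolding gderiv_def by (rule has_derivative_unique)
  then have "inner (D' - D) D' = inner (D' - D) D"
    by (rule fun_cong)
  then have "inner (D' - D) (D' - D) = 0"
    by (simp add: inner_diff_right)
  then show "D' = D"
    by simp
qed (rule assms)

lemma GDERIV_grad: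
  assumes "F differentiable at x"
  shows "GDERIV F x :> grad F x"
proof -
  obtain F' where F': "(F has_derivative F') (at x)"
    using assms unfolding differentiable_def by blast
  then have "linear F'"
    by (rule has_derivative_linear)
  then have "F' = (\<lambda>h. inner h (adjoint F' 1))"
    using adjoint_works[of F' _ 1] by (intro ext) simp
  with F' have "GDERIV F x :> adjoint F' 1"
    unfolding gderiv_def by (rule back_subst)
  then show ?thesis
    using grad_eqI[of F x "adjoint F' 1"] by simp
qed

text \<open>The supremum is taken in the extended reals, so that it is \<open>\<infinity>\<close> when \<open>G\<close> is not Lipschitz.\<close>

definition Lip :: "('a::real_normed_vector \<Rightarrow> 'b::real_normed_vector) \<Rightarrow> ereal"
  where "Lip G = (SUP (x, y)\<in>{(x, y). x \<noteq> y}. ereal (norm (G x - G y) / norm (x - y)))"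

definition C11c :: "('a::euclidean_space \<Rightarrow> real) set"
  where "C11c = {F. convex_on UNIV F \<and> F differentiable_on UNIV \<and>
                    (\<exists>L. L-lipschitz_on UNIV (grad F))}"

definition strongly_convex :: "real \<Rightarrow> ('a::euclidean_space \<Rightarrow> real) \<Rightarrow> bool"
  where "strongly_convex \<eta> F \<longleftrightarrow> convex_on UNIV (\<lambda>x. F x - \<eta> / 2 * (norm x)\<^sup>2)"

end

theory Submission
  imports Defs
begin

text \<open>
  Prescribing the gradient of the extension at the points of \<open>E\<close> turns the problem into a
  Lipschitz selection problem. If \<open>\<xi> : E \<rightarrow> \<real>\<^sup>n\<close> is \<open>CM\<close>-Lipschitz and
  \<open>f x \<ge> f y + \<xi> y \<bullet> (x - y) + \<eta>/2 |x - y|\<^sup>2\<close> on \<open>E\<close>, then \<open>|x - y|\<^sup>2\<close> dominates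
  \<open>|\<xi> x - \<xi> y|\<^sup>2 / (CM)\<^sup>2\<close>. Giving up a part of the strong convexity, namely all of it except
  \<open>\<eta>/p\<^sup>2\<close>, therefore leaves a term of order \<open>\<eta>/(q M\<^sup>2) |\<xi> x - \<xi> y|\<^sup>2\<close>. Such a quadratic gain in
  the gradients is what interpolation by a convex function with gradient of Lipschitz constant of
  order \<open>q M\<^sup>2/\<eta>\<close> requires (\<open>convex_extension_of_jets\<close>). The interpolant is the Moreau envelope of
  a supremum of affine functions.

  The map \<open>\<xi>\<close> has to select from the sets of admissible gradients at the points of \<open>E\<close>. Let
  \<open>\<Gamma>\<^sub>c(y)\<close> consist of the vectors that extend, on every subset of \<open>E\<close> with at most \<open>c\<close> points, one
  of which is \<open>y\<close>, to an \<open>M\<close>-Lipschitz field of admissible gradients (\<open>jet_fiber\<close>). These sets are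
  convex, and Helly's theorem shows that every point of \<open>\<Gamma>\<^sub>c(x)\<close> has a point of \<open>\<Gamma>\<^sub>c\<^sub>'(y)\<close> within
  distance \<open>M |x - y|\<close>, as long as \<open>c\<close> is large compared with \<open>c'\<close> (\<open>jet_fiber_transport\<close>). Starting
  from a large \<open>k\<close> this gives a long chain \<open>\<Gamma> 0 \<subseteq> \<Gamma> 1 \<subseteq> \<dots> \<subseteq> \<Gamma> L\<close> of convex-set-valued maps, each of
  which can be transported into the next.

  Such a chain has a Lipschitz selection of its last member, with \<open>L\<close> and the Lipschitz constant
  depending on the dimension only (\<open>lipschitz_selection_of_chain\<close>). The proof is by induction on the
  dimension of the affine space that contains the sets. Let \<open>\<delta>(x)\<close> be comparable to the diameter of
  the early sets at \<open>x\<close>. In the ball of radius \<open>\<delta>(x)\<close> about \<open>x\<close> the sets all contain a segment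
  close to a fixed one that is long compared with \<open>\<delta>(x)\<close>. Cutting them with the perpendicular
  bisecting hyperplane loses only a constant factor and lowers the dimension, so that there is a
  selection on the ball. On the other hand, at points whose distance exceeds \<open>\<delta>\<close> the early sets are
  so small that all selections staying near them are compatible. A Whitney type partition of unity
  glues the local selections; convexity keeps the averages inside the sets.
\<close>

section \<open>Whitney type gluing of local selections\<close>

text \<open>
  A unit ball is covered by finitely many balls of radius \<open>1/8\<close>, each of which contains at most one
  point of a separated set after rescaling.
\<close>

lemma separated_subset_card_bound:
  obtains N :: nat where
    "\<And>(y::'a::euclidean_space) r S. r > 0 \<Longrightarrow> S \<subseteq> cball y r \<Longrightarrow>
       (\<And>x x'. x \<in> S \<Longrightarrow> x' \<in> S \<Longrightarrow> x \<noteq> x' \<Longrightarrow> r / 4 \<le> norm (x - x')) \<Longrightarrow> finite S \<and> card S \<le> N"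
proof -
  have "compact (cball (0::'a) 1)" by simp
  then obtain k where k: "finite k" "cball (0::'a) 1 \<subseteq> (\<Union>c\<in>k. ball c (1/8))"
    unfolding compact_eq_totally_bounded by (meson zero_less_divide_1_iff zero_less_numeral)
  have "finite S \<and> card S \<le> card k"
    if r: "r > 0" and S: "S \<subseteq> cball y r"
      and sep: "\<And>x x'. x \<in> S \<Longrightarrow> x' \<in> S \<Longrightarrow> x \<noteq> x' \<Longrightarrow> r / 4 \<le> norm (x - x')"
    for y :: 'a and r S
  proof -
    have "\<exists>c\<in>k. norm (c - (x - y) /\<^sub>R r) < 1/8" if "x \<in> S" for x
    proof -
      have "norm (x - y) \<le> r"
        using S that by (auto simp: dist_norm norm_minus_commute)
      then have "(x - y) /\<^sub>R r \<in> cball 0 1"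
        using r by (simp add: divide_inverse_commute[symmetric])
      then have "(x - y) /\<^sub>R r \<in> (\<Union>c\<in>k. ball c (1/8))" using k(2) by blast
      then show ?thesis by (auto simp: dist_norm)
    qed
    then obtain c where c: "\<And>x. x \<in> S \<Longrightarrow> c x \<in> k"
      "\<And>x. x \<in> S \<Longrightarrow> norm (c x - (x - y) /\<^sub>R r) < 1/8"
      by metis
    have "inj_on c S"
    proof (rule inj_onI, rule ccontr)
      fix x x' assume x: "x \<in> S" "x' \<in> S" "c x = c x'" "x \<noteq> x'"
      have "(x - x') /\<^sub>R r = (c x' - (x' - y) /\<^sub>R r) - (c x - (x - y) /\<^sub>R r)"
        using x(3) by (simp add: algebra_simps)
      then have "norm ((x - x') /\<^sub>R r) < 1/8 + 1/8"
        using c(2)[OF x(1)] c(2)[OF x(2)] norm_triangle_ineq4 by (smt (verit))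
      moreover have "norm ((x - x') /\<^sub>R r) = norm (x - x') / r"
        using r by (simp add: divide_inverse mult.commute)
      ultimately have "norm (x - x') / r < 1/4" by linarith
      then have "norm (x - x') < r / 4"
        using r by (simp add: pos_divide_less_eq)
      then show False using sep[OF x(1,2,4)] by simp
    qed
    moreover have "c ` S \<subseteq> k" using c(1) by auto
    ultimately show ?thesis
      using k(1) by (meson card_inj_on_le inj_on_finite)
  qed
  then show ?thesis using that by blast
qed

text \<open>
  The difference of two weighted means is split into the change of the points, which costs at most
  \<open>\<alpha>\<close>, and the change of the weights. For the latter the points may be measured from the second
  mean, so that only the spread \<open>\<gamma>\<close> of the points enters.
\<close>

lemma norm_diff_weighted_means_le:
  fixes a b :: "'i \<Rightarrow> 'b::real_normed_vector" and p q :: "'i \<Rightarrow> real"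
    and \<alpha> \<beta> \<gamma> :: real
  assumes "finite I"
    and p: "\<And>i. i \<in> I \<Longrightarrow> 0 \<le> p i" "1/2 \<le> sum p I"
    and q: "\<And>i. i \<in> I \<Longrightarrow> 0 \<le> q i" "0 < sum q I"
    and ab: "\<And>i. i \<in> I \<Longrightarrow> norm (a i - b i) \<le> \<alpha>"
    and pq: "\<And>i. i \<in> I \<Longrightarrow> \<bar>p i - q i\<bar> \<le> \<beta>"
    and bc: "\<And>i. i \<in> I \<Longrightarrow> norm (b i - c) \<le> \<gamma>"
    and pos: "0 \<le> \<beta>" "0 \<le> \<gamma>"
  shows "norm ((\<Sum>i\<in>I. p i *\<^sub>R a i) /\<^sub>R sum p I - (\<Sum>i\<in>I. q i *\<^sub>R b i) /\<^sub>R sum q I)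
           \<le> \<alpha> + 4 * card I * \<beta> * \<gamma>"
proof -
  define P where "P = sum p I"
  define Q where "Q = sum q I"
  define u where "u = (\<Sum>i\<in>I. p i *\<^sub>R a i) /\<^sub>R P"
  define v where "v = (\<Sum>i\<in>I. q i *\<^sub>R b i) /\<^sub>R Q"
  have P: "P \<ge> 1/2" and Q: "Q > 0" using p q by (auto simp: P_def Q_def)
  have Pu: "P *\<^sub>R u = (\<Sum>i\<in>I. p i *\<^sub>R a i)" and Qv: "Q *\<^sub>R v = (\<Sum>i\<in>I. q i *\<^sub>R b i)"
    using P Q by (auto simp: u_def v_def)
  have "Q *\<^sub>R (v - c) = (\<Sum>i\<in>I. q i *\<^sub>R (b i - c))"
    using Qv by (simp add: scaleR_diff_right sum_subtractf scaleR_sum_left[symmetric] flip: Q_def)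
  also have "norm \<dots> \<le> (\<Sum>i\<in>I. q i * \<gamma>)"
    using q bc by (intro sum_norm_le) (auto intro!: mult_left_mono)
  also have "\<dots> = Q * \<gamma>" by (simp add: Q_def sum_distrib_right)
  finally have vc: "norm (v - c) \<le> \<gamma>" using Q by simp
  have bv: "norm (b i - v) \<le> 2 * \<gamma>" if "i \<in> I" for i
    using bc[OF that] vc norm_triangle_ineq4[of "b i - c" "v - c"] by simp
  have "P *\<^sub>R (u - v) = (\<Sum>i\<in>I. p i *\<^sub>R (a i - b i)) + (\<Sum>i\<in>I. (p i - q i) *\<^sub>R (b i - v))"
  proof -
    have "(\<Sum>i\<in>I. q i *\<^sub>R (b i - v)) = 0"
      using Qv by (simp add: scaleR_diff_right sum_subtractf scaleR_sum_left[symmetric] flip: Q_def)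
    then have "(\<Sum>i\<in>I. (p i - q i) *\<^sub>R (b i - v)) = (\<Sum>i\<in>I. p i *\<^sub>R (b i - v))"
      by (simp add: scaleR_diff_left sum_subtractf)
    then have "(\<Sum>i\<in>I. p i *\<^sub>R (a i - b i)) + (\<Sum>i\<in>I. (p i - q i) *\<^sub>R (b i - v))
       = (\<Sum>i\<in>I. p i *\<^sub>R (a i - b i) + p i *\<^sub>R (b i - v))"
      by (simp add: sum.distrib)
    also have "\<dots> = (\<Sum>i\<in>I. p i *\<^sub>R a i - p i *\<^sub>R v)"
      by (intro sum.cong) (auto simp: algebra_simps)
    also have "\<dots> = P *\<^sub>R (u - v)"
      using Pu by (simp add: scaleR_diff_right sum_subtractf scaleR_sum_left[symmetric] flip: P_def)
    finally show ?thesis by simp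
  qed
  also have "norm \<dots> \<le> (\<Sum>i\<in>I. p i * \<alpha>) + (\<Sum>i\<in>I. \<beta> * (2 * \<gamma>))"
    using p(1) ab pq bv pos
    by (intro norm_triangle_mono sum_norm_le) (auto intro!: mult_left_mono mult_mono)
  also have "\<dots> = P * \<alpha> + 2 * card I * \<beta> * \<gamma>"
    by (simp add: P_def sum_distrib_right)
  also have "\<dots> \<le> P * \<alpha> + P * (4 * card I * \<beta> * \<gamma>)"
  proof -
    have "(1/2) * (4 * card I * \<beta> * \<gamma>) \<le> P * (4 * card I * \<beta> * \<gamma>)"
      using P pos by (intro mult_right_mono) auto
    then show ?thesis by simp
  qed
  finally have "norm (P *\<^sub>R (u - v)) \<le> P * (\<alpha> + 4 * card I * \<beta> * \<gamma>)"
    by (simp only: distrib_left)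
  then have "P * norm (u - v) \<le> P * (\<alpha> + 4 * card I * \<beta> * \<gamma>)"
    using P by simp
  then show ?thesis using P unfolding u_def v_def P_def Q_def by simp
qed

lemma maximal_separated_net:
  fixes \<delta> :: "'a::real_normed_vector \<Rightarrow> real"
  obtains N where "N \<subseteq> A"
    "\<And>x x'. x \<in> N \<Longrightarrow> x' \<in> N \<Longrightarrow> x \<noteq> x' \<Longrightarrow> min (\<delta> x) (\<delta> x') / 4 \<le> norm (x - x')"
    "\<And>y. y \<in> A \<Longrightarrow> y \<notin> N \<Longrightarrow> \<exists>x\<in>N. norm (x - y) < min (\<delta> x) (\<delta> y) / 4"
proof -
  define sep where "sep N \<longleftrightarrow> N \<subseteq> A \<and>
    (\<forall>x\<in>N. \<forall>x'\<in>N. x \<noteq> x' \<longrightarrow> min (\<delta> x) (\<delta> x') / 4 \<le> norm (x - x'))" for N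
  have "\<exists>N\<in>Collect sep. \<forall>X\<in>Collect sep. N \<subseteq> X \<longrightarrow> X = N"
  proof (rule subset_Zorn')
    fix C assume C: "subset.chain (Collect sep) C"
    have "sep (\<Union>C)"
      unfolding sep_def
    proof (intro conjI ballI impI)
      show "\<Union>C \<subseteq> A" using C unfolding subset.chain_def sep_def by blast
      fix x x' assume "x \<in> \<Union>C" "x' \<in> \<Union>C" and ne: "x \<noteq> x'"
      then obtain X where "X \<in> C" "x \<in> X" "x' \<in> X"
        using C unfolding subset.chain_def by blast
      then show "min (\<delta> x) (\<delta> x') / 4 \<le> norm (x - x')"
        using C ne unfolding subset.chain_def sep_def by blast
    qed
    then show "\<Union>C \<in> Collect sep" by simp
  qed
  then obtain N where N: "sep N" and max: "\<And>X. sep X \<Longrightarrow> N \<subseteq> X \<Longrightarrow> X = N" by auto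
  have "\<exists>x\<in>N. norm (x - y) < min (\<delta> x) (\<delta> y) / 4" if y: "y \<in> A" "y \<notin> N" for y
  proof (rule ccontr)
    assume "\<not> ?thesis"
    then have "sep (insert y N)"
      using N y unfolding sep_def
      by (auto simp: not_less norm_minus_commute min.commute)
    then show False using max[of "insert y N"] y by auto
  qed
  then show ?thesis using that[of N] N unfolding sep_def by blast
qed

text \<open>
  The centres \<open>x\<close> of the balls of radius \<open>\<delta> x\<close> are thinned out to a maximal net on which the hat
  functions \<open>max 0 (1 - 2 |x - y| / \<delta> x)\<close> have bounded overlap and a sum of at least \<open>1/2\<close>; averaging
  the local selections with these weights gives the selection \<open>s\<close>. It stays within a multiple of
  \<open>\<delta> y\<close> of \<open>b y\<close>, which settles pairs \<open>y\<close>, \<open>z\<close> with \<open>|y - z|\<close> at least comparable to \<open>\<delta> y\<close>,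
  including the points with \<open>\<delta> y = 0\<close>. For closer pairs the weights change by \<open>O(|y - z| / \<delta> y)\<close>
  while the averaged values have a spread of order \<open>\<delta> y\<close>.
\<close>

lemma glue_local_selections:
  fixes E :: "'a::euclidean_space set" and G :: "'a \<Rightarrow> 'b::real_normed_vector set"
    and \<delta> :: "'a \<Rightarrow> real" and R C :: real and N0 :: nat
  assumes N0: "\<And>(y::'a) r S. r > 0 \<Longrightarrow> S \<subseteq> cball y r \<Longrightarrow>
       (\<And>x x'. x \<in> S \<Longrightarrow> x' \<in> S \<Longrightarrow> x \<noteq> x' \<Longrightarrow> r / 4 \<le> norm (x - x')) \<Longrightarrow> finite S \<and> card S \<le> N0"
    and \<delta>0: "\<And>x. x \<in> E \<Longrightarrow> 0 \<le> \<delta> x"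
    and \<delta>lip: "\<And>x y. x \<in> E \<Longrightarrow> y \<in> E \<Longrightarrow> \<bar>\<delta> x - \<delta> y\<bar> \<le> norm (x - y) / 8"
    and conv: "\<And>x. x \<in> E \<Longrightarrow> convex (G x)" and bG: "\<And>x. x \<in> E \<Longrightarrow> b x \<in> G x"
    and b: "\<And>x y. x \<in> E \<Longrightarrow> y \<in> E \<Longrightarrow> norm (b x - b y) \<le> norm (x - y) + 16 * \<delta> y"
    and loc: "\<And>x y. x \<in> E \<Longrightarrow> 0 < \<delta> x \<Longrightarrow> y \<in> E \<Longrightarrow> norm (x - y) \<le> \<delta> x \<Longrightarrow>
       loc x y \<in> G y \<and> norm (loc x y - b x) \<le> R * \<delta> x"
    and loclip: "\<And>x y z. x \<in> E \<Longrightarrow> 0 < \<delta> x \<Longrightarrow> y \<in> E \<Longrightarrow> norm (x - y) \<le> \<delta> x \<Longrightarrow> z \<in> E \<Longrightarrow>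
       norm (x - z) \<le> \<delta> x \<Longrightarrow> norm (loc x y - loc x z) \<le> C * norm (y - z)"
    and RC: "0 \<le> R" "0 \<le> C"
    and c0_def: "c0 = 18 * (64 * real N0 + 33) + 257"
  obtains s where "\<And>y. y \<in> E \<Longrightarrow> s y \<in> G y"
    "\<And>y z. y \<in> E \<Longrightarrow> z \<in> E \<Longrightarrow> norm (s y - s z) \<le> (C + c0 * (R + 1)) * norm (y - z)"
proof -
  define K where "K = 2 * R + 18"
  have K0: "K \<ge> 0" using RC by (simp add: K_def)
  obtain N where NE: "N \<subseteq> {x\<in>E. 0 < \<delta> x}" and
    sep: "\<And>x x'. x \<in> N \<Longrightarrow> x' \<in> N \<Longrightarrow> x \<noteq> x' \<Longrightarrow> min (\<delta> x) (\<delta> x') / 4 \<le> norm (x - x')" and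
    net: "\<And>y. y \<in> {x\<in>E. 0 < \<delta> x} \<Longrightarrow> y \<notin> N \<Longrightarrow> \<exists>x\<in>N. norm (x - y) < min (\<delta> x) (\<delta> y) / 4"
    by (rule maximal_separated_net[where A = "{x\<in>E. 0 < \<delta> x}" and \<delta> = \<delta>]) blast
  have N: "x \<in> E" "0 < \<delta> x" if "x \<in> N" for x using NE that by auto
  define \<phi> where "\<phi> x y = max 0 (1 - 2 * norm (x - y) / \<delta> x)" for x y
  define J where "J y = {x\<in>N. norm (x - y) < \<delta> x / 2}" for y
  have \<phi>0: "0 \<le> \<phi> x y" for x y by (simp add: \<phi>_def)
  have \<phi>J: "\<phi> x y = 0" if "x \<in> N" "x \<notin> J y" for x y
    using that N[OF that(1)] by (auto simp: \<phi>_def J_def field_simps)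
  have J: "x \<in> E" "0 < \<delta> x" "norm (x - y) \<le> \<delta> x" "\<bar>\<delta> x - \<delta> y\<bar> \<le> \<delta> x / 16"
    "\<bar>\<delta> x - \<delta> y\<bar> \<le> \<delta> y / 15" if "x \<in> J y" "y \<in> E" for x y
  proof -
    have x: "x \<in> E" "0 < \<delta> x" "norm (x - y) < \<delta> x / 2"
      using that N[of x] by (auto simp: J_def)
    show "x \<in> E" "0 < \<delta> x" "norm (x - y) \<le> \<delta> x" "\<bar>\<delta> x - \<delta> y\<bar> \<le> \<delta> x / 16"
      "\<bar>\<delta> x - \<delta> y\<bar> \<le> \<delta> y / 15"
      using x \<delta>lip[OF x(1) that(2)] by linarith+
  qed
  have Jcard: "finite (J y) \<and> card (J y) \<le> N0" if y: "y \<in> E" for y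
  proof (cases "J y = {}")
    case False
    then have "0 < \<delta> y" using J[of _ y] y by fastforce
    show ?thesis
    proof (rule N0[of "\<delta> y * 9/16" "J y" y])
      show "J y \<subseteq> cball y (\<delta> y * 9/16)"
      proof
        fix x assume x: "x \<in> J y"
        have "norm (x - y) < \<delta> x / 2" using x by (simp add: J_def)
        then have "norm (x - y) \<le> \<delta> y * 9/16"
          using J(5)[OF x y] by linarith
        then show "x \<in> cball y (\<delta> y * 9/16)"
          by (simp add: dist_norm norm_minus_commute)
      qed
      fix x x' assume x: "x \<in> J y" "x' \<in> J y" "x \<noteq> x'"
      then have "min (\<delta> x) (\<delta> x') / 4 \<le> norm (x - x')" using sep by (auto simp: J_def)
      moreover have "\<delta> y * 9/16 \<le> \<delta> x" "\<delta> y * 9/16 \<le> \<delta> x'"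
        using J(2,4)[OF x(1) y] J(2,4)[OF x(2) y] by linarith+
      ultimately show "\<delta> y * 9/16 / 4 \<le> norm (x - x')" by linarith
    qed (use \<open>0 < \<delta> y\<close> in auto)
  qed auto
  have \<phi>half: "\<exists>x\<in>J y. 1/2 \<le> \<phi> x y" if y: "y \<in> E" "0 < \<delta> y" for y
  proof -
    obtain x where x: "x \<in> N" "norm (x - y) \<le> \<delta> x / 4"
    proof (cases "y \<in> N")
      case True then show ?thesis using that[of y] y by simp
    next
      case False then show ?thesis using that net[of y] y by fastforce
    qed
    then have "x \<in> J y" "1/2 \<le> \<phi> x y"
      using N[of x] by (auto simp: J_def \<phi>_def field_simps)
    then show ?thesis by blast
  qed
  have \<phi>sum: "1/2 \<le> (\<Sum>x\<in>I. \<phi> x y)" if y: "y \<in> E" "0 < \<delta> y" "J y \<subseteq> I" "finite I" for y I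
  proof -
    obtain x where x: "x \<in> J y" "1/2 \<le> \<phi> x y" using \<phi>half y by blast
    then have "\<phi> x y \<le> (\<Sum>x\<in>I. \<phi> x y)"
      using y \<phi>0 by (intro member_le_sum) auto
    then show ?thesis using x by linarith
  qed
  \<comment> \<open>Where \<open>\<delta>\<close> vanishes there is no ball to average over, but the bound on \<open>b\<close> is a Lipschitz bound there.\<close>
  define s where "s y = (if 0 < \<delta> y then (\<Sum>x\<in>J y. \<phi> x y *\<^sub>R loc x y) /\<^sub>R (\<Sum>x\<in>J y. \<phi> x y) else b y)" for y
  have s_eq: "s y = (\<Sum>x\<in>I. \<phi> x y *\<^sub>R loc x y) /\<^sub>R (\<Sum>x\<in>I. \<phi> x y)"
    if y: "0 < \<delta> y" "J y \<subseteq> I" "finite I" "I \<subseteq> N" for y I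
  proof -
    have "(\<Sum>x\<in>J y. \<phi> x y) = (\<Sum>x\<in>I. \<phi> x y)"
      "(\<Sum>x\<in>J y. \<phi> x y *\<^sub>R loc x y) = (\<Sum>x\<in>I. \<phi> x y *\<^sub>R loc x y)"
      using y \<phi>J by (auto intro!: sum.mono_neutral_left)
    then show ?thesis using y by (simp add: s_def)
  qed
  have locb: "norm (loc x y - b y) \<le> R * \<delta> x + \<delta> x + 16 * \<delta> y"
    if "x \<in> E" "0 < \<delta> x" "y \<in> E" "norm (x - y) \<le> \<delta> x" for x y
    using loc[OF that] b[OF that(1,3)] that(4) norm_triangle_ineq[of "loc x y - b x" "b x - b y"]
    by (simp add: algebra_simps)
  have locK: "norm (loc x y - b y) \<le> K * \<delta> y"
    if "x \<in> E" "0 < \<delta> x" "y \<in> E" "norm (x - y) \<le> \<delta> x" for x y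
  proof -
    have "\<delta> x \<le> 2 * \<delta> y" using \<delta>lip[OF that(1,3)] that \<delta>0[of y] by linarith
    then have "R * \<delta> x \<le> R * (2 * \<delta> y)" "\<delta> x \<le> 2 * \<delta> y"
      using RC by (auto intro: mult_left_mono)
    then show ?thesis using locb[OF that] by (simp add: K_def algebra_simps)
  qed
  have sG: "s y \<in> G y \<and> norm (s y - b y) \<le> K * \<delta> y" if y: "y \<in> E" for y
  proof (cases "0 < \<delta> y")
    case True
    have mem: "s y \<in> A" if "convex A" "\<And>x. x \<in> J y \<Longrightarrow> loc x y \<in> A" for A
    proof -
      have P: "1/2 \<le> (\<Sum>x\<in>J y. \<phi> x y)" using \<phi>sum[of y "J y"] y True Jcard by auto
      have "(\<Sum>x\<in>J y. (\<phi> x y / (\<Sum>x\<in>J y. \<phi> x y)) *\<^sub>R loc x y) \<in> A"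
        using that Jcard[OF y] \<phi>0 P
        by (intro convex_sum) (auto simp: sum_divide_distrib[symmetric])
      moreover have "(\<Sum>x\<in>J y. (\<phi> x y / (\<Sum>x\<in>J y. \<phi> x y)) *\<^sub>R loc x y) = s y"
        using True by (simp add: s_def scaleR_sum_right divide_inverse mult.commute)
      ultimately show ?thesis by simp
    qed
    have "s y \<in> G y" using mem[OF conv[OF y]] loc J y by blast
    moreover have "s y \<in> cball (b y) (K * \<delta> y)"
      using locK J y
      by (intro mem) (auto simp: dist_norm norm_minus_commute)
    ultimately show ?thesis by (simp add: dist_norm norm_minus_commute)
  qed (use bG y \<delta>0[OF y] in \<open>auto simp: s_def\<close>)
  have main: "norm (s y - s z) \<le> (C + c0 * (R + 1)) * norm (y - z)" if y: "y \<in> E" and z: "z \<in> E" for y z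
  proof (cases "norm (y - z) < \<delta> y / 16")
    case False
    define d where "d = norm (y - z)"
    have d0: "d \<ge> 0" by (simp add: d_def)
    have dz: "\<delta> y \<le> 16 * d" "\<delta> z \<le> 17 * d" using False \<delta>lip[OF y z] d0 unfolding d_def by linarith+
    have "norm (s y - s z) \<le> norm (s y - b y) + norm (s z - b z) + norm (b z - b y)"
      using norm_triangle_ineq4[of "s y - b y" "s z - b z"] norm_triangle_ineq4[of "s y - b y - (s z - b z)" "b z - b y"]
      by (simp add: algebra_simps)
    also have "\<dots> \<le> K * \<delta> y + K * \<delta> z + (d + 16 * \<delta> y)"
      using sG[OF y] sG[OF z] b[OF z y] by (simp add: d_def norm_minus_commute)
    also have "\<dots> \<le> K * (16 * d) + K * (17 * d) + (d + 256 * d)"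
      using dz K0 by (intro add_mono mult_left_mono) auto
    also have "\<dots> = (33 * K + 257) * d" by (simp add: algebra_simps)
    also have "\<dots> \<le> (C + c0 * (R + 1)) * d"
      using RC d0 by (intro mult_right_mono) (auto simp: c0_def K_def algebra_simps)
    finally show ?thesis by (simp add: d_def)
  next
    case True
    define d where "d = norm (y - z)"
    define I where "I = J y \<union> J z"
    have d0: "d \<ge> 0" by (simp add: d_def)
    have \<delta>y: "\<delta> y > 0" and d: "d < \<delta> y / 16" using True norm_ge_zero[of "y - z"] by (auto simp: d_def simp del: norm_ge_zero)
    have \<delta>yz: "\<bar>\<delta> y - \<delta> z\<bar> \<le> d / 8" using \<delta>lip[OF y z] by (simp add: d_def)
    have \<delta>z: "\<delta> z > 0" using \<delta>yz d \<delta>y by linarith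
    have I: "finite I" "real (card I) \<le> 2 * N0" "I \<subseteq> N" "J y \<subseteq> I" "J z \<subseteq> I"
      using Jcard[OF y] Jcard[OF z] card_Un_le[of "J y" "J z"] by (auto simp: I_def J_def)
    have Ix: "x \<in> E" "0 < \<delta> x" "norm (x - y) \<le> \<delta> x" "norm (x - z) \<le> \<delta> x" "\<delta> y \<le> 2 * \<delta> x"
      if x: "x \<in> I" for x
    proof -
      show xE: "x \<in> E" and x0: "0 < \<delta> x" using x I N by auto
      have tri: "norm (x - z) \<le> norm (x - y) + d" "norm (x - y) \<le> norm (x - z) + d"
        using norm_triangle_ineq[of "x - y" "y - z"] norm_triangle_ineq[of "x - z" "z - y"]
        by (auto simp: d_def norm_minus_commute)
      consider "norm (x - y) < \<delta> x / 2" | "norm (x - z) < \<delta> x / 2"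
        using x by (auto simp: I_def J_def)
      then have "norm (x - y) \<le> \<delta> x \<and> norm (x - z) \<le> \<delta> x \<and> \<delta> y \<le> 2 * \<delta> x"
      proof cases
        case 1
        then have "\<delta> y \<le> 17/16 * \<delta> x" using \<delta>lip[OF xE y] by linarith
        then show ?thesis using 1 tri d x0 by linarith
      next
        case 2
        then have "\<delta> z \<le> 17/16 * \<delta> x" using \<delta>lip[OF xE z] by linarith
        moreover have "\<delta> y \<le> \<delta> z + d / 8" using \<delta>yz by linarith
        ultimately show ?thesis using 2 tri d x0 d0 by linarith
      qed
      then show "norm (x - y) \<le> \<delta> x" "norm (x - z) \<le> \<delta> x" "\<delta> y \<le> 2 * \<delta> x"
        by auto
    qed
    have "norm (s y - s z) \<le> C * d + 4 * card I * (4 * d / \<delta> y) * (K * \<delta> z)"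
      unfolding s_eq[OF \<delta>y I(4,1,3)] s_eq[OF \<delta>z I(5,1,3)]
    proof (rule norm_diff_weighted_means_le[where c = "b z"])
      show "1/2 \<le> (\<Sum>x\<in>I. \<phi> x y)" using \<phi>sum[OF y \<delta>y I(4,1)] .
      show "0 < (\<Sum>x\<in>I. \<phi> x z)" using \<phi>sum[OF z \<delta>z I(5,1)] by linarith
      show "0 \<le> 4 * d / \<delta> y" using d0 \<delta>y by simp
      show "0 \<le> K * \<delta> z" using K0 \<delta>z by simp
      fix x assume x: "x \<in> I"
      show "norm (loc x y - loc x z) \<le> C * d" using loclip Ix[OF x] y z by (simp add: d_def)
      show "norm (loc x z - b z) \<le> K * \<delta> z" using locK Ix[OF x] z by simp
      have "\<bar>\<phi> x y - \<phi> x z\<bar> \<le> \<bar>2 * norm (x - y) / \<delta> x - 2 * norm (x - z) / \<delta> x\<bar>"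
        by (auto simp: \<phi>_def max_def)
      also have "\<dots> = 2 * \<bar>norm (x - y) - norm (x - z)\<bar> / \<delta> x"
      proof -
        have "2 * norm (x - y) / \<delta> x - 2 * norm (x - z) / \<delta> x = 2 * (norm (x - y) - norm (x - z)) / \<delta> x"
          by (simp add: diff_divide_distrib)
        moreover have "\<bar>2 * (norm (x - y) - norm (x - z))\<bar> = 2 * \<bar>norm (x - y) - norm (x - z)\<bar>"
          by (simp only: abs_mult abs_numeral)
        ultimately show ?thesis using Ix(2)[OF x] by (simp only: abs_divide abs_of_pos)
      qed
      also have "\<dots> \<le> 2 * d / \<delta> x"
        using Ix(2)[OF x] norm_triangle_ineq3[of "x - y" "x - z"]
        by (intro divide_right_mono) (auto simp: d_def norm_minus_commute)
      also have "\<dots> \<le> 4 * d / \<delta> y"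
      proof -
        have "d * \<delta> y \<le> d * (2 * \<delta> x)" using Ix(5)[OF x] d0 by (rule mult_left_mono)
        then show ?thesis using Ix(2)[OF x] \<delta>y by (simp add: field_simps)
      qed
      finally show "\<bar>\<phi> x y - \<phi> x z\<bar> \<le> 4 * d / \<delta> y" .
    qed (auto simp: I(1) \<phi>0)
    also have "\<dots> \<le> C * d + 4 * (2 * N0) * (4 * d / \<delta> y) * (K * (2 * \<delta> y))"
    proof -
      have "4 * real (card I) \<le> 4 * (2 * real N0)" using I(2) by simp
      moreover have "\<delta> z \<le> 2 * \<delta> y" using \<delta>yz d \<delta>y by linarith
      ultimately show ?thesis
        using d0 \<delta>y \<delta>z K0 by (intro add_left_mono mult_mono mult_left_mono) auto
    qed
    also have "\<dots> = (C + 64 * N0 * K) * d"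
    proof -
      have "4 * d / \<delta> y * (K * (2 * \<delta> y)) = 8 * K * d" using \<delta>y by simp
      then have "4 * (2 * real N0) * (4 * d / \<delta> y) * (K * (2 * \<delta> y)) = 4 * (2 * real N0) * (8 * K * d)"
        by (simp only: mult.assoc)
      then show ?thesis by (simp add: distrib_right)
    qed
    also have "\<dots> \<le> (C + c0 * (R + 1)) * d"
    proof (rule mult_right_mono)
      have "64 * N0 * K \<le> 64 * N0 * (18 * (R + 1))"
        using RC by (intro mult_left_mono) (auto simp: K_def)
      also have "\<dots> \<le> c0 * (R + 1)"
        using RC by (simp add: c0_def distrib_right distrib_left)
      finally show "C + 64 * N0 * K \<le> C + c0 * (R + 1)" by simp
    qed (use d0 in auto)
    finally show ?thesis by (simp add: d_def)
  qed
  show ?thesis using that[of s] sG main by simp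
qed

section \<open>Lipschitz selections of chains of convex sets\<close>

text \<open>
  The transport condition with \<open>x = y\<close> contains the inclusion of each set in the next one.
\<close>

definition lipschitz_chain ::
    "real \<Rightarrow> nat \<Rightarrow> 'a::euclidean_space set \<Rightarrow> (nat \<Rightarrow> 'a \<Rightarrow> 'a set) \<Rightarrow> bool" where
  "lipschitz_chain M L E \<Gamma> \<longleftrightarrow>
     (\<forall>i\<le>L. \<forall>x\<in>E. convex (\<Gamma> i x) \<and> bounded (\<Gamma> i x)) \<and>
     (\<forall>x\<in>E. \<Gamma> 0 x \<noteq> {}) \<and>
     (\<forall>i<L. \<forall>x\<in>E. \<forall>y\<in>E. \<forall>\<xi>\<in>\<Gamma> i x. \<exists>\<zeta>\<in>\<Gamma> (Suc i) y. norm (\<zeta> - \<xi>) \<le> M * norm (x - y))"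

lemma lipschitz_chainD:
  assumes "lipschitz_chain M L E \<Gamma>"
  shows "i \<le> L \<Longrightarrow> x \<in> E \<Longrightarrow> convex (\<Gamma> i x)" "i \<le> L \<Longrightarrow> x \<in> E \<Longrightarrow> bounded (\<Gamma> i x)"
    "x \<in> E \<Longrightarrow> \<Gamma> 0 x \<noteq> {}"
    "i < L \<Longrightarrow> x \<in> E \<Longrightarrow> y \<in> E \<Longrightarrow> \<xi> \<in> \<Gamma> i x \<Longrightarrow>
       \<exists>\<zeta>\<in>\<Gamma> (Suc i) y. norm (\<zeta> - \<xi>) \<le> M * norm (x - y)"
  using assms unfolding lipschitz_chain_def by blast+

lemma lipschitz_chain_mono:
  assumes "lipschitz_chain M L E \<Gamma>" "x \<in> E" "i \<le> j" "j \<le> L"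
  shows "\<Gamma> i x \<subseteq> \<Gamma> j x"
  using assms(3,4)
proof (induction j rule: dec_induct)
  case (step k)
  have "\<Gamma> k x \<subseteq> \<Gamma> (Suc k) x"
    using lipschitz_chainD(4)[OF assms(1), of k x x] step assms(2) by fastforce
  then show ?case using step by auto
qed auto

text \<open>
  The statement for the induction on the dimension: \<open>L\<close> steps suffice for sets that lie in an affine
  space \<open>p + V\<close> of dimension at most \<open>D\<close>.
\<close>

definition lipschitz_selectable :: "'a::euclidean_space itself \<Rightarrow> nat \<Rightarrow> nat \<Rightarrow> real \<Rightarrow> bool" where
  "lipschitz_selectable TYPE('a) D L C \<longleftrightarrow> 0 \<le> C \<and>
     (\<forall>M>0. \<forall>(E::'a set) \<Gamma> V p.
        lipschitz_chain M L E \<Gamma> \<and> subspace V \<and> dim V \<le> D \<and> (\<forall>i\<le>L. \<forall>x\<in>E. \<forall>\<xi>\<in>\<Gamma> i x. \<xi> - p \<in> V) \<longrightarrow>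
        (\<exists>s. (\<forall>x\<in>E. s x \<in> \<Gamma> L x) \<and> (\<forall>x\<in>E. \<forall>y\<in>E. norm (s x - s y) \<le> C * M * norm (x - y))))"

text \<open>
  Scaling the target space normalises the transport constant.
\<close>

lemma lipschitz_selectableI_unit:
  assumes C: "0 \<le> C" and unit: "\<And>(E::'a::euclidean_space set) \<Gamma> V p.
       lipschitz_chain 1 L E \<Gamma> \<Longrightarrow> subspace V \<Longrightarrow> dim V \<le> D \<Longrightarrow>
       (\<And>i x \<xi>. i \<le> L \<Longrightarrow> x \<in> E \<Longrightarrow> \<xi> \<in> \<Gamma> i x \<Longrightarrow> \<xi> - p \<in> V) \<Longrightarrow>
       \<exists>s. (\<forall>x\<in>E. s x \<in> \<Gamma> L x) \<and> (\<forall>x\<in>E. \<forall>y\<in>E. norm (s x - s y) \<le> C * norm (x - y))"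
  shows "lipschitz_selectable TYPE('a) D L C"
  unfolding lipschitz_selectable_def
proof (intro conjI allI impI; (elim conjE)?)
  fix M :: real and E :: "'a set" and \<Gamma> V p
  assume M: "M > 0" and ch: "lipschitz_chain M L E \<Gamma>" and V: "subspace V" "dim V \<le> D"
    and p: "\<forall>i\<le>L. \<forall>x\<in>E. \<forall>\<xi>\<in>\<Gamma> i x. \<xi> - p \<in> V"
  define \<Gamma>' where "\<Gamma>' i x = (\<lambda>\<xi>. \<xi> /\<^sub>R M) ` \<Gamma> i x" for i x
  have "lipschitz_chain 1 L E \<Gamma>'"
    unfolding lipschitz_chain_def
  proof (intro conjI allI impI ballI)
    fix i x y \<xi> assume i: "i < L" and x: "x \<in> E" "y \<in> E" and \<xi>: "\<xi> \<in> \<Gamma>' i x"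
    then obtain \<xi>0 where \<xi>0: "\<xi>0 \<in> \<Gamma> i x" "\<xi> = \<xi>0 /\<^sub>R M" by (auto simp: \<Gamma>'_def)
    then obtain \<zeta>0 where \<zeta>0: "\<zeta>0 \<in> \<Gamma> (Suc i) y" "norm (\<zeta>0 - \<xi>0) \<le> M * norm (x - y)"
      using lipschitz_chainD(4)[OF ch i x] by blast
    have "norm (\<zeta>0 /\<^sub>R M - \<xi>) = norm (\<zeta>0 - \<xi>0) / M"
      using M by (simp add: \<xi>0 divide_inverse_commute flip: scaleR_diff_right)
    also have "\<dots> \<le> 1 * norm (x - y)"
      using \<zeta>0 M by (simp add: divide_le_eq mult.commute)
    finally show "\<exists>\<zeta>\<in>\<Gamma>' (Suc i) y. norm (\<zeta> - \<xi>) \<le> 1 * norm (x - y)"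
      using \<zeta>0 by (auto simp: \<Gamma>'_def)
  qed (use lipschitz_chainD[OF ch] in \<open>auto simp: \<Gamma>'_def convex_scaling bounded_scaling\<close>)
  moreover have "\<xi> - p /\<^sub>R M \<in> V" if \<xi>: "i \<le> L" "x \<in> E" "\<xi> \<in> \<Gamma>' i x" for i x \<xi>
  proof -
    obtain \<xi>0 where \<xi>0: "\<xi>0 \<in> \<Gamma> i x" "\<xi> = \<xi>0 /\<^sub>R M" using \<xi> by (auto simp: \<Gamma>'_def)
    have "(\<xi>0 - p) /\<^sub>R M \<in> V" using p \<xi> \<xi>0 V(1) by (intro subspace_scale) auto
    then show ?thesis by (simp add: \<xi>0 scaleR_diff_right)
  qed
  ultimately obtain s where s: "\<And>x. x \<in> E \<Longrightarrow> s x \<in> \<Gamma>' L x"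
    "\<And>x y. x \<in> E \<Longrightarrow> y \<in> E \<Longrightarrow> norm (s x - s y) \<le> C * norm (x - y)"
    using unit[of E \<Gamma>' V "p /\<^sub>R M"] V by blast
  show "\<exists>s. (\<forall>x\<in>E. s x \<in> \<Gamma> L x) \<and> (\<forall>x\<in>E. \<forall>y\<in>E. norm (s x - s y) \<le> C * M * norm (x - y))"
  proof (intro exI[of _ "\<lambda>x. M *\<^sub>R s x"] conjI ballI)
    show "M *\<^sub>R s x \<in> \<Gamma> L x" if "x \<in> E" for x
      using s(1)[OF that] M by (auto simp: \<Gamma>'_def)
    show "norm (M *\<^sub>R s x - M *\<^sub>R s y) \<le> C * M * norm (x - y)" if "x \<in> E" "y \<in> E" for x y
      using mult_left_mono[OF s(2)[OF that], of M] M
      by (simp add: mult.assoc mult.left_commute flip: scaleR_diff_right)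
  qed
qed (use C in auto)

text \<open>
  The point \<open>\<zeta>\<close> is moved towards \<open>c\<close> on the other side of the hyperplane through \<open>m\<close> with normal \<open>e\<close>.
  Since \<open>c\<close> lies at depth at least \<open>\<delta>\<close> and \<open>\<zeta>\<close> at height at most \<open>r\<close>, a fraction of at most \<open>r/\<delta>\<close> of the
  way is enough.
\<close>

lemma slide_to_hyperplane_one_side:
  fixes e m :: "'a::euclidean_space"
  assumes G: "convex G" "\<zeta> \<in> G" "c \<in> G" and \<delta>: "\<delta> > 0"
    and c: "(c - m) \<bullet> e \<le> - \<delta>" and \<zeta>: "0 \<le> (\<zeta> - m) \<bullet> e" "(\<zeta> - m) \<bullet> e \<le> r"
    and R: "norm (\<zeta> - m) \<le> R" "norm (c - m) \<le> R'" "R' \<le> R"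
  shows "\<exists>\<zeta>'\<in>G. (\<zeta>' - m) \<bullet> e = 0 \<and> norm (\<zeta>' - \<zeta>) \<le> r / \<delta> * (R + R') \<and> norm (\<zeta>' - m) \<le> R"
proof -
  define t where "t = ((\<zeta> - m) \<bullet> e) / ((\<zeta> - m) \<bullet> e - (c - m) \<bullet> e)"
  define \<zeta>' where "\<zeta>' = (1 - t) *\<^sub>R \<zeta> + t *\<^sub>R c"
  have den: "\<delta> \<le> (\<zeta> - m) \<bullet> e - (c - m) \<bullet> e" using c \<zeta> by linarith
  have t0: "0 \<le> t" using den \<zeta> \<delta> by (simp add: t_def)
  have t1: "t \<le> 1" using den \<zeta> \<delta> c by (simp add: t_def divide_le_eq_1)
  have tr: "t \<le> r / \<delta>" unfolding t_def using den \<zeta> \<delta> by (intro frac_le) auto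
  have "\<zeta>' \<in> G" unfolding \<zeta>'_def using G t0 t1 by (intro convexD_alt)
  moreover have "(\<zeta>' - m) \<bullet> e = 0"
  proof -
    have "(\<zeta>' - m) \<bullet> e = (\<zeta> - m) \<bullet> e - t * ((\<zeta> - m) \<bullet> e - (c - m) \<bullet> e)"
      by (simp add: \<zeta>'_def algebra_simps)
    also have "\<dots> = 0" using den \<delta> by (simp add: t_def)
    finally show ?thesis .
  qed
  moreover have "norm (\<zeta>' - \<zeta>) \<le> r / \<delta> * (R + R')"
  proof -
    have "\<zeta>' - \<zeta> = t *\<^sub>R ((c - m) - (\<zeta> - m))" by (simp add: \<zeta>'_def algebra_simps)
    then have "norm (\<zeta>' - \<zeta>) = t * norm ((c - m) - (\<zeta> - m))" using t0 by simp
    also have "\<dots> \<le> r / \<delta> * (R + R')"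
      using tr t0 R norm_triangle_ineq4[of "c - m" "\<zeta> - m"] by (intro mult_mono) auto
    finally show ?thesis .
  qed
  moreover have "norm (\<zeta>' - m) \<le> R"
  proof -
    have "\<zeta>' \<in> cball m R" unfolding \<zeta>'_def using R t0 t1
      by (intro convexD_alt) (auto simp: dist_norm norm_minus_commute)
    then show ?thesis by (simp add: dist_norm norm_minus_commute)
  qed
  ultimately show ?thesis by blast
qed

lemma slide_to_hyperplane:
  fixes e m :: "'a::euclidean_space"
  assumes G: "convex G" "\<zeta> \<in> G" "c1 \<in> G" "c2 \<in> G" and \<delta>: "\<delta> > 0"
    and c: "(c1 - m) \<bullet> e \<le> - \<delta>" "\<delta> \<le> (c2 - m) \<bullet> e" and \<zeta>: "\<bar>(\<zeta> - m) \<bullet> e\<bar> \<le> r"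
    and R: "norm (\<zeta> - m) \<le> R" "norm (c1 - m) \<le> R'" "norm (c2 - m) \<le> R'" "R' \<le> R"
  shows "\<exists>\<zeta>'\<in>G. (\<zeta>' - m) \<bullet> e = 0 \<and> norm (\<zeta>' - \<zeta>) \<le> r / \<delta> * (R + R') \<and> norm (\<zeta>' - m) \<le> R"
proof (cases "0 \<le> (\<zeta> - m) \<bullet> e")
  case True
  then show ?thesis
    using slide_to_hyperplane_one_side[OF G(1-3) \<delta> c(1) _ _ R(1,2,4), of r] \<zeta> by simp
next
  case False
  then show ?thesis
    using slide_to_hyperplane_one_side[OF G(1,2,4) \<delta> _ _ _ R(1,3,4), of "- e" r] c \<zeta> by simp
qed

text \<open>
  The endpoints \<open>a\<close>, \<open>b\<close> of a segment of length \<open>4 \<delta>\<close> in \<open>\<Gamma> 2 x0\<close> are transported with an error of at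
  most \<open>\<delta>\<close> to all sets \<open>\<Gamma> 3 y\<close> with \<open>|x0 - y| \<le> \<delta>\<close>. There they remain at depth \<open>\<delta>\<close> on either
  side of the bisecting hyperplane, so that transport can always be followed by a slide back to the
  hyperplane at a bounded factor. The hyperplane sections, cut off by balls with slowly growing
  radius, thus form a chain in one dimension less. The cut-off makes the selection stay near \<open>b\<close>.
\<close>

lemma local_selection_near_long_segment:
  fixes E :: "'a::euclidean_space set"
  assumes IH: "lipschitz_selectable TYPE('a) D K C"
    and ch: "lipschitz_chain 1 (K + 3) E \<Gamma>"
    and V: "subspace V" "dim V \<le> Suc D"
    and p: "\<forall>i\<le>K + 3. \<forall>x\<in>E. \<forall>\<xi>\<in>\<Gamma> i x. \<xi> - p \<in> V"
    and x0: "x0 \<in> E" and \<delta>: "0 < \<delta>"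
    and ab: "a \<in> \<Gamma> 2 x0" "b \<in> \<Gamma> 2 x0" "norm (a - b) = 4 * \<delta>"
  obtains s where
    "\<And>y. y \<in> E \<Longrightarrow> norm (x0 - y) \<le> \<delta> \<Longrightarrow> s y \<in> \<Gamma> (K + 3) y \<and> norm (s y - b) \<le> (2 * real K + 5) * \<delta>"
    "\<And>y z. y \<in> E \<Longrightarrow> norm (x0 - y) \<le> \<delta> \<Longrightarrow> z \<in> E \<Longrightarrow> norm (x0 - z) \<le> \<delta> \<Longrightarrow>
       norm (s y - s z) \<le> C * (2 * real K + 9) * norm (y - z)"
proof -
  define m where "m = (1/2) *\<^sub>R (a + b)"
  define e where "e = (a - b) /\<^sub>R (4 * \<delta>)"
  define U where "U = E \<inter> cball x0 \<delta>"
  \<comment> \<open>The radii grow by \<open>2 \<delta>\<close> per step because two points of the ball have distance at most \<open>2 \<delta>\<close>.\<close>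
  define \<Gamma>' where "\<Gamma>' i y = {\<xi> \<in> \<Gamma> (3 + i) y. (\<xi> - m) \<bullet> e = 0 \<and> norm (\<xi> - m) \<le> (3 + 2 * i) * \<delta>}" for i y
  define V' where "V' = {v \<in> V. v \<bullet> e = 0}"
  have e1: "norm e = 1" using ab \<delta> by (simp add: e_def)
  have am: "a - m = (2 * \<delta>) *\<^sub>R e" and bm: "b - m = - ((2 * \<delta>) *\<^sub>R e)"
    using \<delta> by (auto simp: m_def e_def algebra_simps simp flip: scaleR_left_distrib)
  have ee: "e \<bullet> e = 1" using e1 by (simp add: dot_square_norm)
  have ab_near: "\<exists>b'\<in>\<Gamma> 3 y. \<exists>a'\<in>\<Gamma> 3 y. (b' - m) \<bullet> e \<le> - \<delta> \<and> \<delta> \<le> (a' - m) \<bullet> e \<and>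
      norm (b' - m) \<le> 3 * \<delta> \<and> norm (a' - m) \<le> 3 * \<delta>" if y: "y \<in> U" for y
  proof -
    have y: "y \<in> E" "norm (x0 - y) \<le> \<delta>" using y by (auto simp: U_def dist_norm)
    obtain a' where a': "a' \<in> \<Gamma> 3 y" "norm (a' - a) \<le> \<delta>"
      using lipschitz_chainD(4)[OF ch _ x0 y(1) ab(1)] y(2) by (force simp: eval_nat_numeral)
    obtain b' where b': "b' \<in> \<Gamma> 3 y" "norm (b' - b) \<le> \<delta>"
      using lipschitz_chainD(4)[OF ch _ x0 y(1) ab(2)] y(2) by (force simp: eval_nat_numeral)
    have "\<bar>(a' - a) \<bullet> e\<bar> \<le> \<delta>" "\<bar>(b' - b) \<bullet> e\<bar> \<le> \<delta>"
      using Cauchy_Schwarz_ineq2[of "a' - a" e] Cauchy_Schwarz_ineq2[of "b' - b" e] a' b' e1 by auto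
    moreover have "(a' - m) \<bullet> e = (a' - a) \<bullet> e + 2 * \<delta>" "(b' - m) \<bullet> e = (b' - b) \<bullet> e - 2 * \<delta>"
      using arg_cong[OF am, of "\<lambda>v. v \<bullet> e"] arg_cong[OF bm, of "\<lambda>v. v \<bullet> e"] ee
      by (auto simp: inner_diff_left)
    moreover have "norm (a - m) = 2 * \<delta>" "norm (b - m) = 2 * \<delta>"
      using e1 \<delta> by (auto simp: am bm)
    then have "norm (a' - m) \<le> 3 * \<delta>" "norm (b' - m) \<le> 3 * \<delta>"
      using norm_triangle_ineq[of "a' - a" "a - m"] norm_triangle_ineq[of "b' - b" "b - m"] a' b'
      by auto
    ultimately show ?thesis
      using a'(1) b'(1) by (intro bexI[of _ b'] bexI[of _ a']) auto
  qed
  have chain': "lipschitz_chain (2 * K + 9) K U \<Gamma>'"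
    unfolding lipschitz_chain_def
  proof (intro conjI allI impI ballI)
    fix i y assume i: "i \<le> K" and y: "y \<in> U"
    then have y': "y \<in> E" by (simp add: U_def)
    have *: "\<Gamma>' i y = \<Gamma> (3 + i) y \<inter> {\<xi>. e \<bullet> \<xi> = e \<bullet> m} \<inter> cball m ((3 + 2 * i) * \<delta>)"
      by (auto simp: \<Gamma>'_def dist_norm norm_minus_commute inner_diff_left inner_commute[of e])
    show "convex (\<Gamma>' i y)"
      unfolding * using lipschitz_chainD(1)[OF ch _ y'] i
      by (intro convex_Int convex_hyperplane convex_cball) auto
    show "bounded (\<Gamma>' i y)" unfolding * by (intro bounded_Int) auto
  next
    fix y assume y: "y \<in> U"
    then have y': "y \<in> E" by (simp add: U_def)
    obtain b' a' where ab': "b' \<in> \<Gamma> 3 y" "a' \<in> \<Gamma> 3 y" "(b' - m) \<bullet> e \<le> - \<delta>" "\<delta> \<le> (a' - m) \<bullet> e"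
      "norm (b' - m) \<le> 3 * \<delta>" "norm (a' - m) \<le> 3 * \<delta>" using ab_near[OF y] by blast
    have "\<exists>\<zeta>'\<in>\<Gamma> 3 y. (\<zeta>' - m) \<bullet> e = 0 \<and> norm (\<zeta>' - b') \<le> \<bar>(b' - m) \<bullet> e\<bar> / \<delta> * (3 * \<delta> + 3 * \<delta>) \<and> norm (\<zeta>' - m) \<le> 3 * \<delta>"
      by (rule slide_to_hyperplane[OF _ ab'(1) ab'(1,2) \<delta> ab'(3,4) _ ab'(5,5,6)])
        (use lipschitz_chainD(1)[OF ch _ y', of 3] in auto)
    then show "\<Gamma>' 0 y \<noteq> {}" by (auto simp: \<Gamma>'_def)
  next
    fix i y z \<xi> assume i: "i < K" and y: "y \<in> U" and z: "z \<in> U" and \<xi>: "\<xi> \<in> \<Gamma>' i y"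
    have y': "y \<in> E" "norm (x0 - y) \<le> \<delta>" and z': "z \<in> E" "norm (x0 - z) \<le> \<delta>"
      using y z by (auto simp: U_def dist_norm)
    define d where "d = norm (y - z)"
    have d2: "d \<le> 2 * \<delta>" "0 \<le> d" unfolding d_def
      using norm_triangle_ineq4[of "x0 - z" "x0 - y"] y' z' by auto
    obtain \<zeta> where \<zeta>: "\<zeta> \<in> \<Gamma> (Suc (3 + i)) z" "norm (\<zeta> - \<xi>) \<le> d"
      using lipschitz_chainD(4)[OF ch _ y'(1) z'(1), of "3 + i" \<xi>] \<xi> i by (auto simp: \<Gamma>'_def d_def)
    obtain b' a' where ab': "b' \<in> \<Gamma> 3 z" "a' \<in> \<Gamma> 3 z" "(b' - m) \<bullet> e \<le> - \<delta>" "\<delta> \<le> (a' - m) \<bullet> e"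
      "norm (b' - m) \<le> 3 * \<delta>" "norm (a' - m) \<le> 3 * \<delta>" using ab_near[OF z] by blast
    have sub: "\<Gamma> 3 z \<subseteq> \<Gamma> (Suc (3 + i)) z"
      using i by (intro lipschitz_chain_mono[OF ch z'(1)]) auto
    have "(\<zeta> - m) \<bullet> e = (\<zeta> - \<xi>) \<bullet> e" using \<xi> by (simp add: \<Gamma>'_def inner_diff_left)
    then have \<zeta>e: "\<bar>(\<zeta> - m) \<bullet> e\<bar> \<le> d"
      using Cauchy_Schwarz_ineq2[of "\<zeta> - \<xi>" e] e1 \<zeta> by simp
    have \<xi>m: "norm (\<xi> - m) \<le> (3 + 2 * i) * \<delta>" using \<xi> by (simp add: \<Gamma>'_def)
    have \<zeta>m: "norm (\<zeta> - m) \<le> (5 + 2 * i) * \<delta>"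
      using norm_triangle_ineq[of "\<zeta> - \<xi>" "\<xi> - m"] \<zeta>(2) d2 \<xi>m by (simp add: algebra_simps)
    have "\<exists>\<zeta>'\<in>\<Gamma> (Suc (3 + i)) z. (\<zeta>' - m) \<bullet> e = 0 \<and>
        norm (\<zeta>' - \<zeta>) \<le> d / \<delta> * ((5 + 2 * i) * \<delta> + 3 * \<delta>) \<and> norm (\<zeta>' - m) \<le> (5 + 2 * i) * \<delta>"
    proof (rule slide_to_hyperplane[OF _ \<zeta>(1) _ _ \<delta> ab'(3,4) \<zeta>e \<zeta>m ab'(5,6)])
      show "convex (\<Gamma> (Suc (3 + i)) z)" using lipschitz_chainD(1)[OF ch _ z'(1)] i by simp
      show "3 * \<delta> \<le> (5 + 2 * i) * \<delta>" using \<delta> by (intro mult_right_mono) auto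
    qed (use ab' sub in auto)
    then obtain \<zeta>' where \<zeta>': "\<zeta>' \<in> \<Gamma> (Suc (3 + i)) z" "(\<zeta>' - m) \<bullet> e = 0"
      "norm (\<zeta>' - \<zeta>) \<le> d / \<delta> * ((5 + 2 * i) * \<delta> + 3 * \<delta>)" "norm (\<zeta>' - m) \<le> (5 + 2 * i) * \<delta>" by blast
    have "d / \<delta> * ((5 + 2 * i) * \<delta> + 3 * \<delta>) = d * (8 + 2 * i)"
      using \<delta> by (simp add: field_simps)
    then have "norm (\<zeta>' - \<xi>) \<le> d * (8 + 2 * i) + d"
      using norm_triangle_ineq[of "\<zeta>' - \<zeta>" "\<zeta> - \<xi>"] \<zeta>(2) \<zeta>'(3) by simp
    also have "\<dots> = (9 + 2 * i) * d" by (simp add: algebra_simps)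
    also have "\<dots> \<le> (2 * K + 9) * d" using i d2 by (intro mult_right_mono) auto
    finally have "norm (\<zeta>' - \<xi>) \<le> (2 * K + 9) * norm (y - z)" by (simp add: d_def)
    moreover have "\<zeta>' \<in> \<Gamma>' (Suc i) z" using \<zeta>' by (simp add: \<Gamma>'_def)
    ultimately show "\<exists>\<zeta>\<in>\<Gamma>' (Suc i) z. norm (\<zeta> - \<xi>) \<le> real (2 * K + 9) * norm (y - z)" by auto
  qed
  have ap: "a - p \<in> V" "b - p \<in> V" using p[rule_format, of 2 x0] ab x0 by auto
  have eV: "e \<in> V"
  proof -
    have "a - b \<in> V" using subspace_diff[OF V(1) ap] by simp
    then show ?thesis using V(1) by (simp add: e_def subspace_scale)
  qed
  have V': "subspace V'"
    using V(1) unfolding V'_def subspace_def by (auto simp: inner_add_left)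
  have "e \<notin> V'" by (simp add: V'_def ee)
  then have "V' \<subset> V" using eV unfolding V'_def by blast
  then have "span V' \<subset> span V" using V' V(1) by (simp add: span_eq_iff[THEN iffD2])
  then have "dim V' \<le> D" using dim_psubset[of V' V] V(2) by linarith
  moreover have "\<xi> - m \<in> V'" if \<xi>: "i \<le> K" "y \<in> U" "\<xi> \<in> \<Gamma>' i y" for i y \<xi>
  proof -
    have "\<xi> - p \<in> V" using p[rule_format, of "3 + i" y \<xi>] \<xi> by (auto simp: \<Gamma>'_def U_def)
    moreover have "m - p = (1/2) *\<^sub>R ((a - p) + (b - p))"
      by (simp add: m_def algebra_simps flip: scaleR_left_distrib)
    moreover have "(1/2) *\<^sub>R ((a - p) + (b - p)) \<in> V"
      using ap V(1) by (intro subspace_scale subspace_add)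
    ultimately have "\<xi> - p \<in> V" "m - p \<in> V" by (simp_all only:)
    then have "(\<xi> - p) - (m - p) \<in> V" by (rule subspace_diff[OF V(1)])
    then show ?thesis using \<xi> by (simp add: V'_def \<Gamma>'_def)
  qed
  moreover have "0 < real (2 * K + 9)" by simp
  ultimately obtain s where s: "\<And>y. y \<in> U \<Longrightarrow> s y \<in> \<Gamma>' K y"
    "\<And>y z. y \<in> U \<Longrightarrow> z \<in> U \<Longrightarrow> norm (s y - s z) \<le> C * real (2 * K + 9) * norm (y - z)"
    using IH chain' V' unfolding lipschitz_selectable_def by metis
  show ?thesis
  proof (rule that[of s])
    fix y assume y: "y \<in> E" "norm (x0 - y) \<le> \<delta>"
    then have sy: "s y \<in> \<Gamma>' K y" using s(1) by (simp add: U_def dist_norm)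
    have "norm (s y - b) \<le> norm (s y - m) + norm (b - m)"
      using norm_triangle_ineq4[of "s y - m" "b - m"] by simp
    also have "\<dots> \<le> (3 + 2 * K) * \<delta> + 2 * \<delta>"
      using sy \<delta> e1 by (simp add: \<Gamma>'_def bm)
    finally show "s y \<in> \<Gamma> (K + 3) y \<and> norm (s y - b) \<le> (2 * real K + 5) * \<delta>"
      using sy by (simp add: \<Gamma>'_def algebra_simps)
  qed (use s(2) in \<open>auto simp: U_def dist_norm\<close>)
qed

lemma lipschitz_selectable_0:
  "lipschitz_selectable TYPE('a::euclidean_space) 0 0 0"
proof (rule lipschitz_selectableI_unit)
  fix E :: "'a set" and \<Gamma> V p
  assume ch: "lipschitz_chain 1 0 E \<Gamma>" and V: "dim V \<le> 0"
    and p: "\<And>i x \<xi>. i \<le> 0 \<Longrightarrow> x \<in> E \<Longrightarrow> \<xi> \<in> \<Gamma> i x \<Longrightarrow> \<xi> - p \<in> V"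
  have "V \<subseteq> {0}" using V by simp
  then have "p \<in> \<Gamma> 0 x" if "x \<in> E" for x
    using lipschitz_chainD(3)[OF ch that] p[of 0 x] that by fastforce
  then show "\<exists>s. (\<forall>x\<in>E. s x \<in> \<Gamma> 0 x) \<and> (\<forall>x\<in>E. \<forall>y\<in>E. norm (s x - s y) \<le> 0 * norm (x - y))"
    by (intro exI[of _ "\<lambda>x. p"]) auto
qed simp

lemma segment_point_at_distance:
  fixes b :: "'a::euclidean_space"
  assumes G: "convex G" "bounded G" "b \<in> G" and r: "0 < r" "4 * r \<le> diameter G"
  obtains a where "a \<in> G" "norm (a - b) = r"
proof -
  obtain u v where uv: "u \<in> G" "v \<in> G" "2 * r < dist u v"
    using diameter_lower_bounded[OF G(2), of "2 * r"] r by auto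
  have "dist u v \<le> norm (u - b) + norm (v - b)"
    using norm_triangle_ineq4[of "u - b" "v - b"] by (simp add: dist_norm)
  then obtain w where w: "w \<in> G" "r \<le> norm (w - b)" using uv by (cases "r \<le> norm (u - b)") auto
  define t where "t = r / norm (w - b)"
  have t: "0 \<le> t" "t \<le> 1" using w r by (auto simp: t_def divide_le_eq_1)
  show ?thesis
  proof
    show "(1 - t) *\<^sub>R b + t *\<^sub>R w \<in> G" using G w t by (intro convexD_alt)
    have "(1 - t) *\<^sub>R b + t *\<^sub>R w - b = t *\<^sub>R (w - b)" by (simp add: algebra_simps)
    then show "norm ((1 - t) *\<^sub>R b + t *\<^sub>R w - b) = r" using t w r by (auto simp: t_def)
  qed
qed

text \<open>
  The scale \<open>\<delta>\<close> is the largest \<open>1/8\<close>-Lipschitz function below \<open>diameter (\<Gamma> 2 x) / 16\<close>. Passing from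
  \<open>\<Gamma> 1\<close> to \<open>\<Gamma> 2\<close> at another point, transport bounds the diameter of \<open>\<Gamma> 1 x\<close> by
  \<open>16 \<delta> x\<close>. So \<open>\<Gamma> 2 x\<close> contains a segment of length \<open>4 \<delta> x\<close> starting at a chosen point \<open>b x\<close> of
  \<open>\<Gamma> 0 x\<close>, whereas points of \<open>\<Gamma> 0\<close> at different places differ by at most the distance plus \<open>16 \<delta>\<close>.
  The first fact provides the local selections and the second one makes them compatible.
\<close>

lemma lipschitz_selectable_Suc:
  assumes IH: "lipschitz_selectable TYPE('a::euclidean_space) D K C"
  shows "\<exists>C'. lipschitz_selectable TYPE('a) (Suc D) (K + 3) C'"
proof -
  obtain N0 :: nat where N0: "\<And>(y::'a) r S. r > 0 \<Longrightarrow> S \<subseteq> cball y r \<Longrightarrow>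
       (\<And>x x'. x \<in> S \<Longrightarrow> x' \<in> S \<Longrightarrow> x \<noteq> x' \<Longrightarrow> r / 4 \<le> norm (x - x')) \<Longrightarrow> finite S \<and> card S \<le> N0"
    by (rule separated_subset_card_bound) blast
  have C0: "0 \<le> C" using IH by (simp add: lipschitz_selectable_def)
  define R :: real where "R = 2 * K + 5"
  define c0 :: real where "c0 = 18 * (64 * real N0 + 33) + 257"
  define C1 where "C1 = C * (2 * K + 9)"
  have RC: "0 \<le> R" "0 \<le> C1" using C0 by (auto simp: R_def C1_def)
  have "lipschitz_selectable TYPE('a) (Suc D) (K + 3) (C1 + c0 * (R + 1))"
  proof (rule lipschitz_selectableI_unit)
    fix E :: "'a set" and \<Gamma> V p
    assume ch: "lipschitz_chain 1 (K + 3) E \<Gamma>" and V: "subspace V" "dim V \<le> Suc D"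
      and p: "\<And>i x \<xi>. i \<le> K + 3 \<Longrightarrow> x \<in> E \<Longrightarrow> \<xi> \<in> \<Gamma> i x \<Longrightarrow> \<xi> - p \<in> V"
    have p': "\<forall>i\<le>K + 3. \<forall>x\<in>E. \<forall>\<xi>\<in>\<Gamma> i x. \<xi> - p \<in> V" using p by blast
    note chD = lipschitz_chainD[OF ch]
    have bdd: "bounded (\<Gamma> 1 x)" "bounded (\<Gamma> 2 x)" if "x \<in> E" for x using chD(2) that by auto
    define \<delta> where "\<delta> x = (INF z\<in>E. diameter (\<Gamma> 2 z) + 2 * norm (x - z)) / 16" for x
    have bd: "bdd_below ((\<lambda>z. diameter (\<Gamma> 2 z) + 2 * norm (x - z)) ` E)" for x
      by (rule bdd_belowI2[of _ 0]) (use bdd in \<open>auto intro!: add_nonneg_nonneg diameter_ge_0\<close>)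
    have \<delta>_le: "16 * \<delta> x \<le> diameter (\<Gamma> 2 z) + 2 * norm (x - z)" if "z \<in> E" for x z
      using cINF_lower[OF bd that, of x] by (simp add: \<delta>_def)
    have \<delta>_ge: "c \<le> 16 * \<delta> x" if "x \<in> E" "\<And>z. z \<in> E \<Longrightarrow> c \<le> diameter (\<Gamma> 2 z) + 2 * norm (x - z)" for x c
      using cINF_greatest[of E c "\<lambda>z. diameter (\<Gamma> 2 z) + 2 * norm (x - z)"] that by (auto simp: \<delta>_def)
    have \<delta>0: "0 \<le> \<delta> x" if "x \<in> E" for x
      using bdd by (intro \<delta>_ge[OF that, of 0, simplified]) (auto intro!: add_nonneg_nonneg diameter_ge_0)
    have \<delta>half: "\<delta> x - \<delta> y \<le> norm (x - y) / 8" if x: "x \<in> E" and y: "y \<in> E" for x y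
    proof -
      have "16 * \<delta> x - 2 * norm (x - y) \<le> 16 * \<delta> y"
      proof (rule \<delta>_ge[OF y])
        fix z assume "z \<in> E"
        show "16 * \<delta> x - 2 * norm (x - y) \<le> diameter (\<Gamma> 2 z) + 2 * norm (y - z)"
          using \<delta>_le[OF \<open>z \<in> E\<close>, of x] norm_triangle_ineq[of "x - y" "y - z"] by simp
      qed
      then show ?thesis by simp
    qed
    have \<delta>lip: "\<bar>\<delta> x - \<delta> y\<bar> \<le> norm (x - y) / 8" if "x \<in> E" "y \<in> E" for x y
      using \<delta>half[OF that] \<delta>half[OF that(2,1)] unfolding norm_minus_commute[of y x] by linarith
    have diam1: "norm (\<xi> - \<xi>') \<le> 16 * \<delta> x" if x: "x \<in> E" and \<xi>: "\<xi> \<in> \<Gamma> 1 x" "\<xi>' \<in> \<Gamma> 1 x" for x \<xi> \<xi>'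
    proof (rule \<delta>_ge[OF x])
      fix z assume z: "z \<in> E"
      obtain \<zeta> where \<zeta>: "\<zeta> \<in> \<Gamma> 2 z" "norm (\<zeta> - \<xi>) \<le> norm (x - z)"
        using chD(4)[of 1, OF _ x z \<xi>(1)] by (auto simp: numeral_2_eq_2)
      obtain \<zeta>' where \<zeta>': "\<zeta>' \<in> \<Gamma> 2 z" "norm (\<zeta>' - \<xi>') \<le> norm (x - z)"
        using chD(4)[of 1, OF _ x z \<xi>(2)] by (auto simp: numeral_2_eq_2)
      have "norm (\<zeta> - \<zeta>') \<le> diameter (\<Gamma> 2 z)"
        using diameter_bounded_bound[OF bdd(2)[OF z] \<zeta>(1) \<zeta>'(1)] by (simp add: dist_norm)
      then show "norm (\<xi> - \<xi>') \<le> diameter (\<Gamma> 2 z) + 2 * norm (x - z)"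
        using \<zeta>(2) \<zeta>'(2) norm_triangle_ineq4[of "\<zeta> - \<zeta>'" "\<zeta> - \<xi> - (\<zeta>' - \<xi>')"]
          norm_triangle_ineq4[of "\<zeta> - \<xi>" "\<zeta>' - \<xi>'"] by simp
    qed
    define b where "b x = (SOME \<xi>. \<xi> \<in> \<Gamma> 0 x)" for x
    have b0: "b x \<in> \<Gamma> 0 x" if "x \<in> E" for x
      unfolding b_def using chD(3)[OF that] by (simp add: some_in_eq)
    have mono: "\<Gamma> i x \<subseteq> \<Gamma> j x" if "x \<in> E" "i \<le> j" "j \<le> K + 3" for x i j
      using lipschitz_chain_mono[OF ch that] .
    have bb: "norm (b x - b y) \<le> norm (x - y) + 16 * \<delta> y" if x: "x \<in> E" and y: "y \<in> E" for x y
    proof -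
      obtain \<zeta> where \<zeta>: "\<zeta> \<in> \<Gamma> 1 y" "norm (\<zeta> - b x) \<le> norm (x - y)"
        using chD(4)[of 0, OF _ x y b0[OF x]] by auto
      have "norm (\<zeta> - b y) \<le> 16 * \<delta> y" using diam1[OF y \<zeta>(1)] b0[OF y] mono[OF y, of 0 1] by auto
      then show ?thesis using \<zeta>(2) norm_triangle_ineq4[of "\<zeta> - b y" "\<zeta> - b x"] by simp
    qed
    have "\<exists>s. (\<forall>y. y \<in> E \<and> norm (x - y) \<le> \<delta> x \<longrightarrow> s y \<in> \<Gamma> (K + 3) y \<and> norm (s y - b x) \<le> R * \<delta> x) \<and>
        (\<forall>y z. y \<in> E \<and> norm (x - y) \<le> \<delta> x \<and> z \<in> E \<and> norm (x - z) \<le> \<delta> x \<longrightarrow>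
           norm (s y - s z) \<le> C1 * norm (y - z))" if x: "x \<in> E" "0 < \<delta> x" for x
    proof -
      have b2: "b x \<in> \<Gamma> 2 x" using b0 mono[of x 0 2] x by auto
      have "4 * (4 * \<delta> x) \<le> diameter (\<Gamma> 2 x)" using \<delta>_le[OF x(1), of x] by simp
      then obtain a where a: "a \<in> \<Gamma> 2 x" "norm (a - b x) = 4 * \<delta> x"
        using segment_point_at_distance[of "\<Gamma> 2 x" "b x" "4 * \<delta> x"] chD(1,2)[of 2 x] b2 x by auto
      show ?thesis
      proof (rule local_selection_near_long_segment[OF IH ch V p' x a(1) b2 a(2)], goal_cases)
        case (1 s)
        then show ?case by (intro exI[of _ s]) (auto simp: R_def C1_def)
      qed
    qed
    then obtain loc where loc: "\<And>x y. x \<in> E \<Longrightarrow> 0 < \<delta> x \<Longrightarrow> y \<in> E \<Longrightarrow> norm (x - y) \<le> \<delta> x \<Longrightarrow>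
         loc x y \<in> \<Gamma> (K + 3) y \<and> norm (loc x y - b x) \<le> R * \<delta> x"
      "\<And>x y z. x \<in> E \<Longrightarrow> 0 < \<delta> x \<Longrightarrow> y \<in> E \<Longrightarrow> norm (x - y) \<le> \<delta> x \<Longrightarrow> z \<in> E \<Longrightarrow>
         norm (x - z) \<le> \<delta> x \<Longrightarrow> norm (loc x y - loc x z) \<le> C1 * norm (y - z)"
      by metis
    have conv: "convex (\<Gamma> (K + 3) x)" and bG: "b x \<in> \<Gamma> (K + 3) x" if "x \<in> E" for x
      using chD(1) that b0 mono[of x 0 "K + 3"] by auto
    show "\<exists>s. (\<forall>x\<in>E. s x \<in> \<Gamma> (K + 3) x) \<and>
        (\<forall>x\<in>E. \<forall>y\<in>E. norm (s x - s y) \<le> (C1 + c0 * (R + 1)) * norm (x - y))"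
      by (rule glue_local_selections[where ?N0.0 = N0 and E = E and \<delta> = \<delta> and G = "\<Gamma> (K + 3)" and b = b
            and loc = loc and R = R and C = C1 and ?c0.0 = c0])
        (fact N0 \<delta>0 \<delta>lip conv bG bb loc RC c0_def | blast)+
  qed (use RC in \<open>auto simp: c0_def\<close>)
  then show ?thesis by blast
qed

text \<open>
  Each dimension uses up three steps of the chain.
\<close>

theorem lipschitz_selection_of_chain:
  "\<exists>L C. lipschitz_selectable TYPE('a::euclidean_space) D L C"
proof (induction D)
  case 0
  then show ?case using lipschitz_selectable_0 by blast
next
  case (Suc D)
  then show ?case using lipschitz_selectable_Suc by blast
qed

section \<open>Convex functions with Lipschitz gradient and prescribed jets\<close>

lemma norm_sq_convex_combination:
  fixes a b :: "'a::real_inner"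
  shows "(norm ((1 - t) *\<^sub>R a + t *\<^sub>R b))\<^sup>2
           = (1 - t) * (norm a)\<^sup>2 + t * (norm b)\<^sup>2 - t * (1 - t) * (norm (a - b))\<^sup>2"
  by (simp add: power2_norm_eq_inner inner_commute algebra_simps)

lemma convex_on_half_norm_sq:
  assumes "0 \<le> c"
  shows "convex_on UNIV (\<lambda>x::'a::real_inner. c / 2 * (norm x)\<^sup>2)"
proof (rule convex_onI)
  fix t :: real and x y :: 'a assume t: "0 < t" "t < 1"
  have "(norm ((1 - t) *\<^sub>R x + t *\<^sub>R y))\<^sup>2 \<le> (1 - t) * (norm x)\<^sup>2 + t * (norm y)\<^sup>2"
    using t by (simp add: norm_sq_convex_combination)
  from mult_left_mono[OF this, of "c / 2"]
  moreover have "c / 2 * ((1 - t) * (norm x)\<^sup>2 + t * (norm y)\<^sup>2)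
      = (1 - t) * (c / 2 * (norm x)\<^sup>2) + t * (c / 2 * (norm y)\<^sup>2)"
    by (simp add: field_simps)
  ultimately show "c / 2 * (norm ((1 - t) *\<^sub>R x + t *\<^sub>R y))\<^sup>2
      \<le> (1 - t) * (c / 2 * (norm x)\<^sup>2) + t * (c / 2 * (norm y)\<^sup>2)"
    using assms by simp
qed simp

text \<open>
  Restriction to the line through \<open>x\<close> and \<open>y\<close> reduces this to one variable.
\<close>

lemma convex_on_above_tangent_plane:
  fixes F :: "'a::euclidean_space \<Rightarrow> real"
  assumes conv: "convex_on UNIV F" and D: "GDERIV F x :> D"
  shows "F x + D \<bullet> (y - x) \<le> F y"
proof -
  define g where "g t = F (x + t *\<^sub>R (y - x))" for t
  have "convex_on UNIV g"
  proof (rule convex_onI)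
    fix t u v :: real assume t: "0 < t" "t < 1"
    have "x + ((1 - t) *\<^sub>R u + t *\<^sub>R v) *\<^sub>R (y - x)
        = (1 - t) *\<^sub>R (x + u *\<^sub>R (y - x)) + t *\<^sub>R (x + v *\<^sub>R (y - x))"
      by (simp add: algebra_simps)
    then show "g ((1 - t) *\<^sub>R u + t *\<^sub>R v) \<le> (1 - t) * g u + t * g v"
      using convex_onD[OF conv, of t] t by (simp add: g_def)
  qed simp
  moreover have "(g has_real_derivative D \<bullet> (y - x)) (at 0)"
  proof -
    have "(F has_derivative (\<lambda>h. h \<bullet> D)) (at (x + 0 *\<^sub>R (y - x)))"
      using D by (simp add: gderiv_def)
    moreover have "((\<lambda>t. x + t *\<^sub>R (y - x)) has_derivative (\<lambda>t. t *\<^sub>R (y - x))) (at 0)"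
      by (auto intro!: derivative_eq_intros)
    ultimately have "((\<lambda>t. F (x + t *\<^sub>R (y - x))) has_derivative (\<lambda>t. (t *\<^sub>R (y - x)) \<bullet> D)) (at 0)"
      by (rule has_derivative_compose[rotated])
    then show ?thesis
      by (simp add: g_def[abs_def] has_field_derivative_def inner_commute mult_commute_abs)
  qed
  ultimately have "D \<bullet> (y - x) * (1 - 0) \<le> g 1 - g 0"
    by (intro convex_on_imp_above_tangent[where A = UNIV]) auto
  then show ?thesis by (simp add: g_def)
qed

text \<open>
  By convexity, reflecting the upper bound at \<open>z\<close> gives a quadratic lower bound, so \<open>v\<close> is the
  gradient. Its Lipschitz constant results from comparing the tangent plane at \<open>z\<close> with the upper
  bound at \<open>z'\<close> in the point \<open>z' + h\<close>, where \<open>h\<close> has length \<open>|z - z'|\<close> and the direction of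
  \<open>v z - v z'\<close>.
\<close>

lemma C11c_of_quadratic_upper_bound:
  fixes F :: "'a::euclidean_space \<Rightarrow> real"
  assumes conv: "convex_on UNIV F" and L: "0 \<le> L"
    and upper: "\<And>z z'. F z' \<le> F z + v z \<bullet> (z' - z) + L / 2 * (norm (z' - z))\<^sup>2"
  shows "F \<in> C11c" "Lip (grad F) \<le> ereal L"
proof -
  have lower: "F z + v z \<bullet> h - L / 2 * (norm h)\<^sup>2 \<le> F (z + h)" for z h
  proof -
    have "(1 - 1/2) *\<^sub>R (z + h) + (1/2) *\<^sub>R (z - h) = z"
      by (simp add: algebra_simps flip: scaleR_left_distrib)
    then have "F z \<le> F (z + h) / 2 + F (z - h) / 2"
      using convex_onD[OF conv, of "1/2" "z + h" "z - h"] by simp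
    then show ?thesis using upper[where z = z and z' = "z - h"] by simp
  qed
  have gd: "GDERIV F z :> v z" for z
    unfolding gderiv_def has_derivative_at
  proof (intro conjI)
    show "bounded_linear (\<lambda>h. h \<bullet> v z)" by (rule bounded_linear_inner_left)
    show "(\<lambda>h. norm (F (z + h) - F z - h \<bullet> v z) / norm h) \<midarrow>0\<rightarrow> 0"
    proof (rule Lim_null_comparison)
      have "norm (norm (F (z + h) - F z - h \<bullet> v z) / norm h) \<le> L / 2 * norm h" for h
      proof -
        have "\<bar>F (z + h) - F z - h \<bullet> v z\<bar> \<le> L / 2 * (norm h)\<^sup>2"
        proof -
          have "F (z + h) \<le> F z + v z \<bullet> h + L / 2 * (norm h)\<^sup>2"
            using upper[where z = z and z' = "z + h"] by simp
          then show ?thesis using lower[of z h] unfolding inner_commute[of h] by linarith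
        qed
        then show ?thesis
          using L by (cases "h = 0") (auto simp: divide_le_eq power2_eq_square mult.assoc)
      qed
      then show "\<forall>\<^sub>F h in at 0. norm (norm (F (z + h) - F z - h \<bullet> v z) / norm h) \<le> L / 2 * norm h"
        by simp
      show "(\<lambda>h::'a. L / 2 * norm h) \<midarrow>0\<rightarrow> 0"
        by (auto intro!: tendsto_eq_intros)
    qed
  qed
  have tangent: "F z + v z \<bullet> (z' - z) \<le> F z'" for z z'
    by (rule convex_on_above_tangent_plane[OF conv gd])
  have lip: "norm (v z - v z') \<le> L * norm (z - z')" for z z'
  proof (cases "v z = v z'")
    case False
    define d where "d = norm (z' - z)"
    define w where "w = norm (v z - v z')"
    define h where "h = (d / w) *\<^sub>R (v z - v z')"
    have w: "w > 0" using False by (simp add: w_def)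
    have d: "d \<ge> 0" by (simp add: d_def)
    have "F z + v z \<bullet> (z' + h - z) \<le> F (z' + h)" by (rule tangent)
    moreover have "F (z' + h) \<le> F z' + v z' \<bullet> h + L / 2 * (norm h)\<^sup>2"
      using upper[where z = z' and z' = "z' + h"] by simp
    moreover have "F z' \<le> F z + v z \<bullet> (z' - z) + L / 2 * d\<^sup>2"
      using upper[where z = z and z' = z'] by (simp add: d_def)
    ultimately have "(v z - v z') \<bullet> h \<le> L / 2 * (norm h)\<^sup>2 + L / 2 * d\<^sup>2"
      by (simp add: algebra_simps)
    moreover have "(v z - v z') \<bullet> h = d * w"
      using w by (simp add: h_def w_def dot_square_norm power2_eq_square)
    moreover have "norm h = d" using w d by (simp add: h_def w_def)
    ultimately have "d * w \<le> d * (L * d)" by (simp add: power2_eq_square mult.commute mult.left_commute)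
    show ?thesis
    proof (cases "d = 0")
      case True then show ?thesis using False by (simp add: d_def)
    next
      case False
      then have "w \<le> L * d" using \<open>d * w \<le> d * (L * d)\<close> d by simp
      then show ?thesis by (simp add: w_def d_def norm_minus_commute)
    qed
  qed (use L in simp)
  have grad: "grad F = v" using grad_eqI[OF gd] by blast
  have "F differentiable_on UNIV"
    using gd by (auto simp: differentiable_on_def differentiable_def gderiv_def)
  moreover have "L-lipschitz_on UNIV v" using lip L by (intro lipschitz_onI) (auto simp: dist_norm)
  ultimately show "F \<in> C11c" using conv by (auto simp: C11c_def grad)
  show "Lip (grad F) \<le> ereal L"
    unfolding Lip_def grad
    by (rule SUP_least) (use lip in \<open>auto simp: divide_le_eq\<close>)
qed

lemma proximal_point_exists:
  fixes h :: "'a::euclidean_space \<Rightarrow> real"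
  assumes h: "continuous_on UNIV h" and L: "0 < L" and lower: "\<And>w. c + u \<bullet> w \<le> h w"
  shows "\<exists>w0. \<forall>w. h w0 + L / 2 * (norm (z - w0))\<^sup>2 \<le> h w + L / 2 * (norm (z - w))\<^sup>2"
proof -
  define k where "k = h z - c - u \<bullet> z"
  have k: "0 \<le> k" using lower[of z] by (simp add: k_def)
  \<comment> \<open>Outside this radius the quadratic term outweighs the affine lower bound.\<close>
  define r where "r = max 1 (2 * (norm u + k) / L)"
  define \<phi> where "\<phi> w = h w + L / 2 * (norm (z - w))\<^sup>2" for w
  have "continuous_on (cball z r) \<phi>"
    unfolding \<phi>_def by (intro continuous_intros continuous_on_subset[OF h]) auto
  moreover have "cball z r \<noteq> {}" by (simp add: r_def)
  ultimately obtain w0 where w0: "w0 \<in> cball z r" "\<And>w. w \<in> cball z r \<Longrightarrow> \<phi> w0 \<le> \<phi> w"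
    using continuous_attains_inf[of "cball z r" \<phi>] by auto
  have "\<phi> w0 \<le> \<phi> w" for w
  proof (cases "w \<in> cball z r")
    case False
    define \<rho> where "\<rho> = norm (z - w)"
    have \<rho>: "1 \<le> \<rho>" "2 * (norm u + k) / L \<le> \<rho>" using False by (auto simp: \<rho>_def dist_norm r_def)
    have "k \<le> (L / 2 * \<rho> - norm u) * 1" using \<rho>(2) L by (simp add: field_simps)
    also have "\<dots> \<le> (L / 2 * \<rho> - norm u) * \<rho>"
      using \<rho> k \<open>k \<le> _\<close> by (intro mult_left_mono) auto
    finally have "k \<le> L / 2 * \<rho>\<^sup>2 - norm u * \<rho>" by (simp add: algebra_simps power2_eq_square)
    moreover have "u \<bullet> (z - w) \<le> norm u * \<rho>" unfolding \<rho>_def by (rule norm_cauchy_schwarz)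
    ultimately have "h z \<le> c + u \<bullet> w + L / 2 * \<rho>\<^sup>2" by (simp add: k_def inner_diff_right)
    then have "\<phi> z \<le> \<phi> w" using lower[of w] by (simp add: \<phi>_def \<rho>_def)
    moreover have "\<phi> w0 \<le> \<phi> z" using w0(2)[of z] by (simp add: r_def)
    ultimately show ?thesis by simp
  qed (use w0 in auto)
  then show ?thesis unfolding \<phi>_def by blast
qed

text \<open>
  The envelope \<open>F z = min\<^sub>w h w + L/2 |z - w|\<^sup>2\<close> is convex as a partial minimum of a jointly convex
  function. Inserting the minimiser \<open>P z\<close> as a competitor at \<open>z'\<close> gives the quadratic upper bound.
\<close>

lemma moreau_envelope_exists:
  fixes h :: "'a::euclidean_space \<Rightarrow> real"
  assumes h: "convex_on UNIV h" and L: "0 < L" and lower: "\<And>w. c + u \<bullet> w \<le> h w"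
  obtains F P where "convex_on UNIV F" "\<And>z. F z = h (P z) + L / 2 * (norm (z - P z))\<^sup>2"
    "\<And>z w. F z \<le> h w + L / 2 * (norm (z - w))\<^sup>2"
    "\<And>z z'. F z' \<le> F z + (L *\<^sub>R (z - P z)) \<bullet> (z' - z) + L / 2 * (norm (z' - z))\<^sup>2"
proof -
  have "continuous_on UNIV h" using h by (intro convex_on_continuous) auto
  then obtain P where P: "\<And>z w. h (P z) + L / 2 * (norm (z - P z))\<^sup>2 \<le> h w + L / 2 * (norm (z - w))\<^sup>2"
    using proximal_point_exists[OF _ L lower] by metis
  define F where "F z = h (P z) + L / 2 * (norm (z - P z))\<^sup>2" for z
  have "convex_on UNIV F"
  proof (rule convex_onI)
    fix t :: real and x y :: 'a assume t: "0 < t" "t < 1"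
    have "F ((1 - t) *\<^sub>R x + t *\<^sub>R y) \<le> h ((1 - t) *\<^sub>R P x + t *\<^sub>R P y)
        + L / 2 * (norm (((1 - t) *\<^sub>R x + t *\<^sub>R y) - ((1 - t) *\<^sub>R P x + t *\<^sub>R P y)))\<^sup>2"
      unfolding F_def by (rule P)
    also have "((1 - t) *\<^sub>R x + t *\<^sub>R y) - ((1 - t) *\<^sub>R P x + t *\<^sub>R P y)
        = (1 - t) *\<^sub>R (x - P x) + t *\<^sub>R (y - P y)"
      by (simp add: algebra_simps)
    also have "L / 2 * (norm ((1 - t) *\<^sub>R (x - P x) + t *\<^sub>R (y - P y)))\<^sup>2
        \<le> (1 - t) * (L / 2 * (norm (x - P x))\<^sup>2) + t * (L / 2 * (norm (y - P y))\<^sup>2)"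
      using convex_onD[OF convex_on_half_norm_sq, of L t "x - P x" "y - P y"] L t by simp
    also have "h ((1 - t) *\<^sub>R P x + t *\<^sub>R P y) \<le> (1 - t) * h (P x) + t * h (P y)"
      using convex_onD[OF h, of t] t by simp
    finally show "F ((1 - t) *\<^sub>R x + t *\<^sub>R y) \<le> (1 - t) * F x + t * F y"
      by (simp add: F_def algebra_simps)
  qed simp
  moreover have "F z' \<le> F z + (L *\<^sub>R (z - P z)) \<bullet> (z' - z) + L / 2 * (norm (z' - z))\<^sup>2" for z z'
  proof -
    have "F z' \<le> h (P z) + L / 2 * (norm ((z - P z) + (z' - z)))\<^sup>2"
      using P[of z' "P z"] by (simp add: F_def)
    also have "(norm ((z - P z) + (z' - z)))\<^sup>2 = (norm (z - P z))\<^sup>2 + 2 * ((z - P z) \<bullet> (z' - z)) + (norm (z' - z))\<^sup>2"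
      by (simp only: power2_norm_eq_inner inner_add_left inner_add_right inner_commute)
    finally show ?thesis by (simp add: F_def algebra_simps)
  qed
  ultimately show ?thesis using that[of F P] P unfolding F_def by blast
qed

text \<open>
  If \<open>F\<close> is the Moreau envelope of \<open>h\<close>, then \<open>F y = f y\<close> with gradient \<open>\<xi> y\<close> means that \<open>h\<close> has at
  \<open>y - \<xi> y / L\<close> the value \<open>f y - |\<xi> y|\<^sup>2 / (2 L)\<close> and the subgradient \<open>\<xi> y\<close>. So \<open>h\<close> is taken to be
  the supremum of the affine functions with these data, and the hypothesis on the jets says
  exactly that none of them exceeds the prescribed value at the contact point of another one.
\<close>

lemma convex_extension_of_jets:
  fixes E :: "'a::euclidean_space set" and f :: "'a \<Rightarrow> real" and \<xi> :: "'a \<Rightarrow> 'a"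
  assumes E: "E \<noteq> {}" and bdd: "\<And>x. x \<in> E \<Longrightarrow> norm (\<xi> x) \<le> B" and L: "0 < L"
    and jets: "\<And>x y. x \<in> E \<Longrightarrow> y \<in> E \<Longrightarrow>
      f y + \<xi> y \<bullet> (x - y) + 1 / (2 * L) * (norm (\<xi> x - \<xi> y))\<^sup>2 \<le> f x"
  obtains F v where "convex_on UNIV F" "\<And>x. x \<in> E \<Longrightarrow> F x = f x"
    "\<And>z z'. F z' \<le> F z + v z \<bullet> (z' - z) + L / 2 * (norm (z' - z))\<^sup>2"
proof -
  obtain y0 where y0: "y0 \<in> E" using E by blast
  define A where "A y w = f y + (norm (\<xi> y))\<^sup>2 / (2 * L) + \<xi> y \<bullet> (w - y)" for y w
  define h where "h w = (SUP y\<in>E. A y w)" for w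
  have bd: "bdd_above ((\<lambda>y. A y w) ` E)" for w
  proof (rule bdd_aboveI2)
    fix y assume y: "y \<in> E"
    have "f y + \<xi> y \<bullet> (y0 - y) \<le> f y0"
      using jets[OF y0 y] L by (smt (verit) divide_nonneg_nonneg mult_nonneg_nonneg zero_le_power2)
    moreover have "\<xi> y \<bullet> (w - y0) \<le> B * norm (w - y0)"
      using norm_cauchy_schwarz[of "\<xi> y" "w - y0"] mult_right_mono[OF bdd[OF y], of "norm (w - y0)"] by simp
    moreover have "(norm (\<xi> y))\<^sup>2 / (2 * L) \<le> B\<^sup>2 / (2 * L)"
      using bdd[OF y] L by (intro divide_right_mono power_mono) auto
    ultimately show "A y w \<le> f y0 + B\<^sup>2 / (2 * L) + B * norm (w - y0)"
      by (simp add: A_def inner_diff_right)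
  qed
  have A_le: "A y w \<le> h w" if "y \<in> E" for y w
    unfolding h_def by (rule cSUP_upper[OF that bd])
  have h_le: "h w \<le> c" if "\<And>y. y \<in> E \<Longrightarrow> A y w \<le> c" for w c
    unfolding h_def by (rule cSUP_least[OF E that])
  have "convex_on UNIV h"
  proof (rule convex_onI)
    fix t :: real and x y :: 'a assume t: "0 < t" "t < 1"
    show "h ((1 - t) *\<^sub>R x + t *\<^sub>R y) \<le> (1 - t) * h x + t * h y"
    proof (rule h_le)
      fix z assume z: "z \<in> E"
      have "A z ((1 - t) *\<^sub>R x + t *\<^sub>R y) = (1 - t) * A z x + t * A z y"
      proof -
        have "c + u \<bullet> ((1 - t) *\<^sub>R x + t *\<^sub>R y - q) = (1 - t) * (c + u \<bullet> (x - q)) + t * (c + u \<bullet> (y - q))"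
          for c and u q :: 'a
          by (simp add: algebra_simps)
        then show ?thesis unfolding A_def .
      qed
      also have "\<dots> \<le> (1 - t) * h x + t * h y"
        using A_le[OF z] t by (intro add_mono mult_left_mono) auto
      finally show "A z ((1 - t) *\<^sub>R x + t *\<^sub>R y) \<le> (1 - t) * h x + t * h y" .
    qed
  qed simp
  moreover have "(f y0 + (norm (\<xi> y0))\<^sup>2 / (2 * L) - \<xi> y0 \<bullet> y0) + \<xi> y0 \<bullet> w \<le> h w" for w
    using A_le[OF y0, of w] by (simp add: A_def inner_diff_right)
  ultimately obtain F P where F: "convex_on UNIV F" "\<And>z. F z = h (P z) + L / 2 * (norm (z - P z))\<^sup>2"
    "\<And>z w. F z \<le> h w + L / 2 * (norm (z - w))\<^sup>2"
    "\<And>z z'. F z' \<le> F z + (L *\<^sub>R (z - P z)) \<bullet> (z' - z) + L / 2 * (norm (z' - z))\<^sup>2"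
    using moreau_envelope_exists[OF _ L] by blast
  have "F y = f y" if y: "y \<in> E" for y
  proof (rule antisym)
    define w where "w = y - \<xi> y /\<^sub>R L"
    have "h w \<le> f y - (norm (\<xi> y))\<^sup>2 / (2 * L)"
    proof (rule h_le)
      fix x assume x: "x \<in> E"
      have "A x w = f x + \<xi> x \<bullet> (y - x) + 1 / (2 * L) * (norm (\<xi> y - \<xi> x))\<^sup>2 - (norm (\<xi> y))\<^sup>2 / (2 * L)"
      proof -
        have "\<xi> x \<bullet> (w - x) = \<xi> x \<bullet> (y - x) - (\<xi> x \<bullet> \<xi> y) / L"
          by (simp add: w_def inner_diff_right divide_inverse mult.commute)
        moreover have "(norm (\<xi> y - \<xi> x))\<^sup>2 = (norm (\<xi> y))\<^sup>2 + (norm (\<xi> x))\<^sup>2 - 2 * (\<xi> x \<bullet> \<xi> y)"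
          by (simp add: power2_norm_eq_inner inner_commute algebra_simps)
        then have "1 / (2 * L) * (norm (\<xi> y - \<xi> x))\<^sup>2
            = (norm (\<xi> y))\<^sup>2 / (2 * L) + (norm (\<xi> x))\<^sup>2 / (2 * L) - (\<xi> x \<bullet> \<xi> y) / L"
          using L by (simp add: diff_divide_distrib add_divide_distrib)
        ultimately show ?thesis unfolding A_def by linarith
      qed
      then show "A x w \<le> f y - (norm (\<xi> y))\<^sup>2 / (2 * L)" using jets[OF y x] by simp
    qed
    moreover have "L / 2 * (norm (y - w))\<^sup>2 = (norm (\<xi> y))\<^sup>2 / (2 * L)"
      using L by (simp add: w_def power_mult_distrib power2_eq_square field_simps)
    ultimately show "F y \<le> f y" using F(3)[of y w] by simp
  next
    define d where "d = P y - y"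
    have "0 \<le> (norm (\<xi> y + L *\<^sub>R d))\<^sup>2 / (2 * L)" using L by simp
    also have "\<dots> = (norm (\<xi> y))\<^sup>2 / (2 * L) + \<xi> y \<bullet> d + L / 2 * (norm d)\<^sup>2"
    proof -
      have "(norm (\<xi> y + L *\<^sub>R d))\<^sup>2 = (norm (\<xi> y))\<^sup>2 + 2 * L * (\<xi> y \<bullet> d) + L\<^sup>2 * (norm d)\<^sup>2"
        unfolding power2_norm_eq_inner
        by (simp add: inner_add_left inner_add_right inner_commute power2_eq_square algebra_simps)
      then show ?thesis using L by (simp add: add_divide_distrib power2_eq_square)
    qed
    finally show "f y \<le> F y"
      using A_le[OF y, of "P y"] F(2)[of y] by (simp add: A_def d_def norm_minus_commute)
  qed
  then show ?thesis using that[of F "\<lambda>z. L *\<^sub>R (z - P z)"] F by blast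
qed

text \<open>
  After subtracting \<open>\<mu>/2 |x|\<^sup>2\<close>, the surplus \<open>(\<eta> - \<mu>)/2 |x - y|\<^sup>2\<close> of strong convexity pays for the
  quadratic term in the gradients.
\<close>

lemma strongly_convex_extension_of_jets:
  fixes E :: "'a::euclidean_space set"
  assumes E: "E \<noteq> {}" "bounded E" and \<mu>: "0 \<le> \<mu>" and K: "0 \<le> K" and L: "0 < L" "(K + \<mu>)\<^sup>2 \<le> L * (\<eta> - \<mu>)"
    and lip: "\<And>x y. x \<in> E \<Longrightarrow> y \<in> E \<Longrightarrow> norm (\<xi> x - \<xi> y) \<le> K * norm (x - y)"
    and jets: "\<And>x y. x \<in> E \<Longrightarrow> y \<in> E \<Longrightarrow> f y + \<xi> y \<bullet> (x - y) + \<eta> / 2 * (norm (x - y))\<^sup>2 \<le> f x"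
  shows "\<exists>F\<in>C11c. strongly_convex \<mu> F \<and> (\<forall>x\<in>E. F x = f x) \<and> Lip (grad F) \<le> ereal (L + \<mu>)"
proof -
  define \<xi>' where "\<xi>' x = \<xi> x - \<mu> *\<^sub>R x" for x
  define f' where "f' x = f x - \<mu> / 2 * (norm x)\<^sup>2" for x
  have lip': "norm (\<xi>' x - \<xi>' y) \<le> (K + \<mu>) * norm (x - y)" if "x \<in> E" "y \<in> E" for x y
  proof -
    have "\<xi>' x - \<xi>' y = (\<xi> x - \<xi> y) - \<mu> *\<^sub>R (x - y)" by (simp add: \<xi>'_def algebra_simps)
    then have "norm (\<xi>' x - \<xi>' y) \<le> norm (\<xi> x - \<xi> y) + norm (\<mu> *\<^sub>R (x - y))"
      by (metis norm_triangle_ineq4)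
    then show ?thesis using lip[OF that] \<mu>
      by (simp only: norm_scaleR abs_of_nonneg distrib_right)
  qed
  obtain x0 where x0: "x0 \<in> E" using E by blast
  obtain r where r: "\<And>x. x \<in> E \<Longrightarrow> norm (x - x0) \<le> r"
    using E(2) unfolding bounded_any_center[where a = x0] by (auto simp: dist_norm norm_minus_commute)
  have bdd: "norm (\<xi>' x) \<le> norm (\<xi>' x0) + (K + \<mu>) * r" if x: "x \<in> E" for x
    using norm_triangle_ineq2[of "\<xi>' x" "\<xi>' x0"] lip'[OF x x0] mult_left_mono[OF r[OF x], of "K + \<mu>"] K \<mu> by simp
  have jets': "f' y + \<xi>' y \<bullet> (x - y) + 1 / (2 * L) * (norm (\<xi>' x - \<xi>' y))\<^sup>2 \<le> f' x"
    if xy: "x \<in> E" "y \<in> E" for x y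
  proof -
    have "(norm (\<xi>' x - \<xi>' y))\<^sup>2 \<le> ((K + \<mu>) * norm (x - y))\<^sup>2"
      using lip'[OF xy] by (intro power_mono) auto
    also have "\<dots> \<le> L * (\<eta> - \<mu>) * (norm (x - y))\<^sup>2"
      unfolding power_mult_distrib using L by (intro mult_right_mono) auto
    finally have "1 / (2 * L) * (norm (\<xi>' x - \<xi>' y))\<^sup>2 \<le> (\<eta> - \<mu>) / 2 * (norm (x - y))\<^sup>2"
      using L(1) by (simp add: field_simps)
    moreover have "\<mu> / 2 * (norm x)\<^sup>2 = \<mu> / 2 * (norm y)\<^sup>2 + \<mu> * (y \<bullet> (x - y)) + \<mu> / 2 * (norm (x - y))\<^sup>2"
      by (simp add: power2_norm_eq_inner inner_commute algebra_simps)
    moreover have "\<xi>' y \<bullet> (x - y) = \<xi> y \<bullet> (x - y) - \<mu> * (y \<bullet> (x - y))"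
      by (simp add: \<xi>'_def inner_diff_left)
    moreover have "(\<eta> - \<mu>) / 2 * (norm (x - y))\<^sup>2 = \<eta> / 2 * (norm (x - y))\<^sup>2 - \<mu> / 2 * (norm (x - y))\<^sup>2"
      by (simp add: left_diff_distrib diff_divide_distrib)
    ultimately show ?thesis
      using jets[OF xy] unfolding f'_def by linarith
  qed
  obtain G v where G: "convex_on UNIV G" "\<And>x. x \<in> E \<Longrightarrow> G x = f' x"
    "\<And>z z'. G z' \<le> G z + v z \<bullet> (z' - z) + L / 2 * (norm (z' - z))\<^sup>2"
    using convex_extension_of_jets[OF E(1) bdd L(1) jets'] by blast
  define F where "F x = G x + \<mu> / 2 * (norm x)\<^sup>2" for x
  have F: "convex_on UNIV F"
    unfolding F_def by (intro convex_on_add G(1) convex_on_half_norm_sq \<mu>)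
  have up: "F z' \<le> F z + (v z + \<mu> *\<^sub>R z) \<bullet> (z' - z) + (L + \<mu>) / 2 * (norm (z' - z))\<^sup>2" for z z'
  proof -
    have "\<mu> / 2 * (norm z')\<^sup>2 = \<mu> / 2 * (norm z)\<^sup>2 + \<mu> * (z \<bullet> (z' - z)) + \<mu> / 2 * (norm (z' - z))\<^sup>2"
      by (simp add: power2_norm_eq_inner inner_commute algebra_simps)
    then show ?thesis using G(3)[of z' z]
      by (simp add: F_def inner_add_left distrib_right add_divide_distrib)
  qed
  have "strongly_convex \<mu> F" using G(1) by (simp add: strongly_convex_def F_def)
  moreover have "F x = f x" if "x \<in> E" for x using G(2)[OF that] by (simp add: F_def f'_def)
  ultimately show ?thesis
    using C11c_of_quadratic_upper_bound[OF F _ up] L(1) \<mu> by auto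
qed

lemma C11c_jets:
  assumes F: "F \<in> C11c" "strongly_convex \<eta> F" and M: "0 \<le> M" "Lip (grad F) \<le> ereal M"
  shows "F y + grad F y \<bullet> (x - y) + \<eta> / 2 * (norm (x - y))\<^sup>2 \<le> F x"
    and "norm (grad F x - grad F y) \<le> M * norm (x - y)"
proof -
  define G where "G x = F x - \<eta> / 2 * (norm x)\<^sup>2" for x
  have "F differentiable at y" using F(1) by (auto simp: C11c_def differentiable_on_def)
  then have "(F has_derivative (\<lambda>h. h \<bullet> grad F y)) (at y)"
    using GDERIV_grad unfolding gderiv_def by blast
  then have "GDERIV G y :> grad F y - \<eta> *\<^sub>R y"
    unfolding gderiv_def G_def power2_norm_eq_inner
    by (auto intro!: derivative_eq_intros simp: inner_diff_right inner_commute algebra_simps)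
  moreover have "convex_on UNIV G" using F(2) by (simp add: strongly_convex_def G_def[abs_def])
  ultimately have "G y + (grad F y - \<eta> *\<^sub>R y) \<bullet> (x - y) \<le> G x"
    by (intro convex_on_above_tangent_plane)
  moreover have "\<eta> / 2 * (norm x)\<^sup>2 = \<eta> / 2 * (norm y)\<^sup>2 + \<eta> * (y \<bullet> (x - y)) + \<eta> / 2 * (norm (x - y))\<^sup>2"
    by (simp add: power2_norm_eq_inner inner_commute algebra_simps)
  ultimately show "F y + grad F y \<bullet> (x - y) + \<eta> / 2 * (norm (x - y))\<^sup>2 \<le> F x"
    unfolding G_def inner_diff_left inner_scaleR_left by linarith
  show "norm (grad F x - grad F y) \<le> M * norm (x - y)"
  proof (cases "x = y")
    case False
    then have "ereal (norm (grad F x - grad F y) / norm (x - y)) \<le> Lip (grad F)"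
      unfolding Lip_def by (intro SUP_upper2[of "(x, y)"]) auto
    then have "norm (grad F x - grad F y) / norm (x - y) \<le> M" using M(2) order_trans by fastforce
    then show ?thesis using False by (simp add: divide_le_eq)
  qed simp
qed

section \<open>Admissible gradient fields and Helly's theorem\<close>

text \<open>
  Helly's theorem for finite families, extended to arbitrary ones by compactness.
\<close>

lemma Helly_compact_family:
  fixes T :: "'i \<Rightarrow> 'a::euclidean_space set"
  assumes T: "\<And>i. i \<in> I \<Longrightarrow> compact (T i)" "\<And>i. i \<in> I \<Longrightarrow> convex (T i)"
    and fin: "\<And>J. J \<subseteq> I \<Longrightarrow> finite J \<Longrightarrow> card J \<le> DIM('a) + 1 \<Longrightarrow> \<Inter>(T ` J) \<noteq> {}"
  shows "\<Inter>(T ` I) \<noteq> {}"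
proof (rule compact_fip_Heine_Borel)
  have small: "\<Inter>\<G> \<noteq> {}" if "\<G> \<subseteq> T ` I" "finite \<G>" "card \<G> \<le> DIM('a) + 1" for \<G>
  proof -
    obtain J where "J \<subseteq> I" "inj_on T J" "\<G> = T ` J"
      using \<open>\<G> \<subseteq> T ` I\<close> unfolding subset_image_inj by blast
    then show ?thesis using fin[of J] that by (simp add: card_image finite_image_iff)
  qed
  fix \<F> assume \<F>: "finite \<F>" "\<F> \<subseteq> T ` I"
  show "\<Inter>\<F> \<noteq> {}"
  proof (cases "card \<F> \<le> DIM('a) + 1")
    case False
    show ?thesis
    proof (rule Helly)
      show "DIM('a) + 1 \<le> card \<F>" using False by linarith
      show "\<forall>s\<in>\<F>. convex s" using \<F>(2) T(2) by blast
      fix \<G> assume \<G>: "\<G> \<subseteq> \<F>" "card \<G> = DIM('a) + 1"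
      show "\<Inter>\<G> \<noteq> {}"
      proof (rule small)
        show "\<G> \<subseteq> T ` I" using \<G>(1) \<F>(2) by (rule subset_trans)
        show "finite \<G>" using \<G>(1) \<F>(1) by (rule finite_subset)
      qed (use \<G>(2) in simp)
    qed
  next
    case True
    show ?thesis by (rule small[OF \<F>(2,1) True])
  qed
qed (use T in auto)

text \<open>
  Candidates for the gradients, on \<open>S\<close>, of an \<open>\<eta>\<close>-strongly convex interpolant. The values are
  confined to a subspace \<open>V\<close> because components orthogonal to all differences of points of \<open>E\<close> are
  not controlled by \<open>f\<close>.
\<close>

definition jets :: "('a::euclidean_space \<Rightarrow> real) \<Rightarrow> real \<Rightarrow> real \<Rightarrow> 'a set \<Rightarrow> 'a set \<Rightarrow> ('a \<Rightarrow> 'a) set" where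
  "jets f \<eta> M V S = {\<omega>. \<forall>x\<in>S. \<omega> x \<in> V \<and>
     (\<forall>y\<in>S. f y + \<omega> y \<bullet> (x - y) + \<eta> / 2 * (norm (x - y))\<^sup>2 \<le> f x \<and> norm (\<omega> x - \<omega> y) \<le> M * norm (x - y))}"

lemma jetsD:
  assumes "\<omega> \<in> jets f \<eta> M V S" "x \<in> S"
  shows "\<omega> x \<in> V"
    "y \<in> S \<Longrightarrow> f y + \<omega> y \<bullet> (x - y) + \<eta> / 2 * (norm (x - y))\<^sup>2 \<le> f x"
    "y \<in> S \<Longrightarrow> norm (\<omega> x - \<omega> y) \<le> M * norm (x - y)"
  using assms unfolding jets_def by auto

lemma jets_antimono: "S \<subseteq> S' \<Longrightarrow> jets f \<eta> M V S' \<subseteq> jets f \<eta> M V S"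
  by (auto simp: jets_def subset_iff)

lemma convex_jet_values:
  assumes "subspace V" "convex C"
  shows "convex ((\<lambda>\<omega>. \<omega> y) ` {\<omega> \<in> jets f \<eta> M V S. \<omega> x \<in> C})"
proof (rule convexI)
  fix a b :: 'a and u v :: real
  assume a: "a \<in> (\<lambda>\<omega>. \<omega> y) ` {\<omega> \<in> jets f \<eta> M V S. \<omega> x \<in> C}"
    and b: "b \<in> (\<lambda>\<omega>. \<omega> y) ` {\<omega> \<in> jets f \<eta> M V S. \<omega> x \<in> C}"
    and uv: "0 \<le> u" "0 \<le> v" "u + v = 1"
  obtain \<alpha> where \<alpha>: "\<alpha> \<in> jets f \<eta> M V S" "\<alpha> x \<in> C" "a = \<alpha> y" using a by blast
  obtain \<beta> where \<beta>: "\<beta> \<in> jets f \<eta> M V S" "\<beta> x \<in> C" "b = \<beta> y" using b by blast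
  define \<omega> where "\<omega> z = u *\<^sub>R \<alpha> z + v *\<^sub>R \<beta> z" for z
  have "\<omega> \<in> jets f \<eta> M V S"
    unfolding jets_def
  proof (intro CollectI ballI conjI)
    fix p q assume p: "p \<in> S" and q: "q \<in> S"
    have "f q + \<omega> q \<bullet> (p - q) + \<eta> / 2 * (norm (p - q))\<^sup>2
        = u * (f q + \<alpha> q \<bullet> (p - q) + \<eta> / 2 * (norm (p - q))\<^sup>2) + v * (f q + \<beta> q \<bullet> (p - q) + \<eta> / 2 * (norm (p - q))\<^sup>2)"
    proof -
      have "c + \<omega> q \<bullet> (p - q) + d = u * (c + \<alpha> q \<bullet> (p - q) + d) + v * (c + \<beta> q \<bullet> (p - q) + d)" for c d
      proof -
        have v: "v = 1 - u" using uv by simp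
        show ?thesis unfolding \<omega>_def v inner_add_left inner_scaleR_left by (simp add: left_diff_distrib distrib_left)
      qed
      then show ?thesis .
    qed
    also have "\<dots> \<le> f p"
      using uv jetsD(2)[OF \<alpha>(1) p q] jetsD(2)[OF \<beta>(1) p q] by (intro convex_bound_le) auto
    finally show "f q + \<omega> q \<bullet> (p - q) + \<eta> / 2 * (norm (p - q))\<^sup>2 \<le> f p" .
    have "norm (\<omega> p - \<omega> q) \<le> norm (u *\<^sub>R (\<alpha> p - \<alpha> q)) + norm (v *\<^sub>R (\<beta> p - \<beta> q))"
      using norm_triangle_ineq[of "u *\<^sub>R (\<alpha> p - \<alpha> q)" "v *\<^sub>R (\<beta> p - \<beta> q)"] by (simp add: \<omega>_def algebra_simps)
    also have "\<dots> = u * norm (\<alpha> p - \<alpha> q) + v * norm (\<beta> p - \<beta> q)" using uv by (simp only: norm_scaleR abs_of_nonneg)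
    also have "\<dots> \<le> M * norm (p - q)"
      using uv jetsD(3)[OF \<alpha>(1) p q] jetsD(3)[OF \<beta>(1) p q] by (intro convex_bound_le) auto
    finally show "norm (\<omega> p - \<omega> q) \<le> M * norm (p - q)" .
  next
    fix p assume p: "p \<in> S"
    show "\<omega> p \<in> V"
      unfolding \<omega>_def using jetsD(1)[OF \<alpha>(1) p] jetsD(1)[OF \<beta>(1) p] assms(1)
      by (intro subspace_add subspace_scale)
  qed
  moreover have "\<omega> x \<in> C" unfolding \<omega>_def using \<alpha> \<beta> uv assms(2) by (intro convexD)
  moreover have "u *\<^sub>R a + v *\<^sub>R b = \<omega> y" by (simp add: \<omega>_def \<alpha> \<beta>)
  ultimately show "u *\<^sub>R a + v *\<^sub>R b \<in> (\<lambda>\<omega>. \<omega> y) ` {\<omega> \<in> jets f \<eta> M V S. \<omega> x \<in> C}" by blast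
qed

text \<open>
  One value in a compact set and the Lipschitz condition confine all values on \<open>S\<close> to balls, so
  Tychonoff's theorem applies to the fields that vanish off \<open>S\<close>.
\<close>

lemma compact_jet_values:
  assumes V: "closed V" and C: "compact C" and x: "x \<in> S" and y: "y \<in> S"
  shows "compact ((\<lambda>\<omega>. \<omega> y) ` {\<omega> \<in> jets f \<eta> M V S. \<omega> x \<in> C})"
proof -
  have cont: "continuous_on UNIV (\<lambda>\<omega>::'a \<Rightarrow> 'a. \<omega> z)" for z by simp
  have "jets f \<eta> M V S = (\<Inter>p\<in>S. {\<omega>. \<omega> p \<in> V} \<inter>
      (\<Inter>q\<in>S. {\<omega>. f q + \<omega> q \<bullet> (p - q) + \<eta> / 2 * (norm (p - q))\<^sup>2 \<le> f p} \<inter> {\<omega>. norm (\<omega> p - \<omega> q) \<le> M * norm (p - q)}))"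
    by (auto simp: jets_def)
  moreover have clV: "closed {\<omega>::'a \<Rightarrow> 'a. \<omega> p \<in> A}" if "closed A" for p A
    using closed_vimage[OF that cont] by (simp add: vimage_def)
  ultimately have "closed (jets f \<eta> M V S)"
    using V by (auto intro!: closed_INT closed_Int closed_Collect_le continuous_intros cont)
  moreover have "closed {\<omega>::'a \<Rightarrow> 'a. \<omega> x \<in> C}" using clV C compact_imp_closed by blast
  ultimately have cl: "closed {\<omega> \<in> jets f \<eta> M V S. \<omega> x \<in> C}"
    by (simp add: Collect_conj_eq closed_Int)
  obtain B where B: "\<And>c. c \<in> C \<Longrightarrow> norm c \<le> B"
    using compact_imp_bounded[OF C] by (auto simp: bounded_iff)
  define K where "K z = (if z \<in> S then cball 0 (B + M * norm (z - x)) else {0::'a})" for z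
  define Q where "Q = PiE UNIV K"
  have "compactin (product_topology (\<lambda>_. euclidean) UNIV) Q"
    unfolding Q_def compactin_PiE by (auto simp: K_def)
  then have "compact Q" by (simp add: euclidean_product_topology)
  then have "compact (Q \<inter> {\<omega> \<in> jets f \<eta> M V S. \<omega> x \<in> C})" using cl by (rule compact_Int_closed)
  then have "compact ((\<lambda>\<omega>. \<omega> y) ` (Q \<inter> {\<omega> \<in> jets f \<eta> M V S. \<omega> x \<in> C}))"
    by (intro compact_continuous_image continuous_on_subset[OF cont]) auto
  moreover have "(\<lambda>\<omega>. \<omega> y) ` (Q \<inter> {\<omega> \<in> jets f \<eta> M V S. \<omega> x \<in> C}) = (\<lambda>\<omega>. \<omega> y) ` {\<omega> \<in> jets f \<eta> M V S. \<omega> x \<in> C}"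
  proof (intro antisym subsetI)
    fix a assume "a \<in> (\<lambda>\<omega>. \<omega> y) ` {\<omega> \<in> jets f \<eta> M V S. \<omega> x \<in> C}"
    then obtain \<omega> where \<omega>: "\<omega> \<in> jets f \<eta> M V S" "\<omega> x \<in> C" "a = \<omega> y" by blast
    define \<omega>' where "\<omega>' z = (if z \<in> S then \<omega> z else 0)" for z
    have "\<omega>' \<in> jets f \<eta> M V S" using \<omega>(1) by (simp add: jets_def \<omega>'_def)
    moreover have "\<omega>' \<in> Q"
      unfolding Q_def
    proof (rule PiE_I)
      fix z
      have "norm (\<omega> z) \<le> B + M * norm (z - x)" if "z \<in> S"
        using jetsD(3)[OF \<omega>(1) that x] B[OF \<omega>(2)] norm_triangle_ineq2[of "\<omega> z" "\<omega> x"] by simp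
      then show "\<omega>' z \<in> K z" by (simp add: K_def \<omega>'_def)
    qed simp
    ultimately show "a \<in> (\<lambda>\<omega>. \<omega> y) ` (Q \<inter> {\<omega> \<in> jets f \<eta> M V S. \<omega> x \<in> C})"
      using \<omega> x y by (intro image_eqI[of _ _ \<omega>']) (auto simp: \<omega>'_def)
  qed blast
  ultimately show ?thesis by simp
qed

definition jet_fiber :: "('a::euclidean_space \<Rightarrow> real) \<Rightarrow> real \<Rightarrow> real \<Rightarrow> 'a set \<Rightarrow> 'a set \<Rightarrow> nat \<Rightarrow> 'a \<Rightarrow> 'a set" where
  "jet_fiber f \<eta> M V E c y = {\<xi> \<in> V. \<forall>S\<subseteq>E. finite S \<and> card S \<le> c \<and> y \<in> S \<longrightarrow> (\<exists>\<omega>\<in>jets f \<eta> M V S. \<omega> y = \<xi>)}"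

text \<open>
  For each small \<open>S\<close> the values at \<open>y\<close> of the fields on \<open>S \<union> {x}\<close> with value \<open>\<xi>\<close> at \<open>x\<close> form a compact
  convex set. At most \<open>n + 1\<close> of them have a common point, namely the value of a field on
  the union of the sets \<open>S\<close>, which is small enough for the hypothesis on \<open>\<xi>\<close>; by Helly's theorem all
  of them have one.
\<close>

lemma jet_fiber_transport:
  fixes E :: "'a::euclidean_space set"
  assumes V: "subspace V" and x: "x \<in> E" and y: "y \<in> E"
    and \<xi>: "\<xi> \<in> jet_fiber f \<eta> M V E ((DIM('a) + 1) * (c + 1) + 2) x"
  shows "\<exists>\<zeta>\<in>jet_fiber f \<eta> M V E c y. norm (\<zeta> - \<xi>) \<le> M * norm (x - y)"
proof -
  define I where "I = {S. S \<subseteq> E \<and> finite S \<and> card S \<le> c + 1 \<and> y \<in> S}"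
  define T where "T S = (\<lambda>\<omega>. \<omega> y) ` {\<omega> \<in> jets f \<eta> M V (insert x S). \<omega> x \<in> {\<xi>}}" for S
  have "\<Inter>(T ` I) \<noteq> {}"
  proof (rule Helly_compact_family)
    fix S assume S: "S \<in> I"
    show "compact (T S)" unfolding T_def
      using S by (intro compact_jet_values closed_subspace V) (auto simp: I_def)
    show "convex (T S)" unfolding T_def by (intro convex_jet_values V) auto
  next
    fix J assume J: "J \<subseteq> I" "finite J" "card J \<le> DIM('a) + 1"
    define U where "U = insert x (insert y (\<Union>J))"
    have "card (\<Union>J) \<le> (\<Sum>S\<in>J. card S)" by (rule card_Union_le_sum_card)
    also have "\<dots> \<le> card J * (c + 1)"
      using sum_bounded_above[of J card "c + 1"] J(1) by (auto simp: I_def)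
    also have "\<dots> \<le> (DIM('a) + 1) * (c + 1)" using J(3) by (rule mult_right_mono) simp
    finally have "card (\<Union>J) \<le> (DIM('a) + 1) * (c + 1)" .
    moreover have "card U \<le> card (\<Union>J) + 2"
      using card_insert_le_m1[of "card (\<Union>J) + 2" "insert y (\<Union>J)" x]
        card_insert_le_m1[of "card (\<Union>J) + 1" "\<Union>J" y] by (simp add: U_def)
    ultimately have "card U \<le> (DIM('a) + 1) * (c + 1) + 2" by linarith
    moreover have fU: "finite U" using J by (auto simp: U_def I_def)
    moreover have "U \<subseteq> E" using J x y by (auto simp: U_def I_def)
    ultimately obtain \<omega> where \<omega>: "\<omega> \<in> jets f \<eta> M V U" "\<omega> x = \<xi>"
      using \<xi> unfolding jet_fiber_def U_def by blast
    have "\<omega> y \<in> T S" if "S \<in> J" for S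
      unfolding T_def using \<omega> jets_antimono[of "insert x S" U f \<eta> M V] that by (auto simp: U_def)
    then show "\<Inter>(T ` J) \<noteq> {}" by blast
  qed
  then obtain \<zeta> where \<zeta>: "\<And>S. S \<in> I \<Longrightarrow> \<zeta> \<in> T S" by blast
  have "{y} \<in> I" using y by (simp add: I_def)
  then obtain \<omega> where \<omega>: "\<omega> \<in> jets f \<eta> M V {x, y}" "\<omega> x = \<xi>" "\<zeta> = \<omega> y"
    using \<zeta>[of "{y}"] by (auto simp: T_def)
  have near: "norm (\<zeta> - \<xi>) \<le> M * norm (x - y)" and "\<zeta> \<in> V"
    using jetsD(3)[OF \<omega>(1), of y x] jetsD(1)[OF \<omega>(1), of y] \<omega>(2,3) by (auto simp: norm_minus_commute[of y x])
  have "\<exists>\<omega>\<in>jets f \<eta> M V S. \<omega> y = \<zeta>" if S: "S \<subseteq> E" "finite S" "card S \<le> c" "y \<in> S" for S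
  proof -
    have "S \<in> I" using S by (simp add: I_def)
    then obtain \<omega>' where "\<omega>' \<in> jets f \<eta> M V (insert x S)" "\<zeta> = \<omega>' y"
      using \<zeta>[of S] unfolding T_def by blast
    then show ?thesis using jets_antimono[of S "insert x S" f \<eta> M V] by blast
  qed
  then have "\<zeta> \<in> jet_fiber f \<eta> M V E c y"
    unfolding jet_fiber_def using \<open>\<zeta> \<in> V\<close> by blast
  then show ?thesis using near by (rule bexI[rotated])
qed

lemma jet_fiber_pairs:
  assumes "\<xi> \<in> jet_fiber f \<eta> M V E c y" "2 \<le> c" "x \<in> E" "y \<in> E"
  obtains \<omega> where "\<omega> \<in> jets f \<eta> M V {x, y}" "\<omega> y = \<xi>"
proof -
  have "card {x, y} \<le> c" using assms(2) by (simp add: card_insert_if)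
  then have "\<exists>\<omega>\<in>jets f \<eta> M V {x, y}. \<omega> y = \<xi>"
    using assms unfolding jet_fiber_def by simp
  then show ?thesis using that by blast
qed

text \<open>
  The inequality at \<open>y\<close> bounds the inner product from above. The one at \<open>x\<close> bounds
  \<open>\<omega> x \<bullet> (x - y)\<close> from below, and replacing \<open>\<omega> x\<close> by \<open>\<omega> y\<close> costs at most \<open>M |x - y|\<^sup>2\<close>.
\<close>

lemma jet_inner_bound:
  assumes "\<omega> \<in> jets f \<eta> M V S" "x \<in> S" "y \<in> S" "0 \<le> \<eta>" "0 \<le> M"
  shows "\<bar>\<omega> y \<bullet> (x - y)\<bar> \<le> \<bar>f x - f y\<bar> + M * (norm (x - y))\<^sup>2"
proof -
  have q: "0 \<le> \<eta> / 2 * (norm (x - y))\<^sup>2" using assms by simp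
  have "f y + \<omega> y \<bullet> (x - y) + \<eta> / 2 * (norm (x - y))\<^sup>2 \<le> f x" using jetsD(2)[OF assms(1-3)] .
  moreover have "f x + \<omega> x \<bullet> (y - x) + \<eta> / 2 * (norm (y - x))\<^sup>2 \<le> f y" using jetsD(2)[OF assms(1,3,2)] .
  moreover have "(\<omega> x - \<omega> y) \<bullet> (x - y) \<le> M * (norm (x - y))\<^sup>2"
  proof -
    have "(\<omega> x - \<omega> y) \<bullet> (x - y) \<le> norm (\<omega> x - \<omega> y) * norm (x - y)" by (rule norm_cauchy_schwarz)
    also have "\<dots> \<le> (M * norm (x - y)) * norm (x - y)"
      using jetsD(3)[OF assms(1-3)] by (intro mult_right_mono) auto
    finally show ?thesis by (simp add: power2_eq_square mult.assoc)
  qed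
  moreover have "0 \<le> M * (norm (x - y))\<^sup>2" using assms by simp
  moreover have "\<omega> x \<bullet> (y - x) = - (\<omega> x \<bullet> (x - y))" by (simp add: inner_diff_right)
  ultimately show ?thesis using q unfolding norm_minus_commute[of y x] inner_diff_left by linarith
qed

text \<open>
  The vectors whose inner products with \<open>T\<close> are bounded form a subspace.
\<close>

lemma bounded_of_bounded_inner_span:
  fixes T V :: "'a::euclidean_space set"
  assumes V: "V = span D" "T \<subseteq> V" and D: "\<And>d. d \<in> D \<Longrightarrow> \<exists>c. \<forall>\<xi>\<in>T. \<bar>\<xi> \<bullet> d\<bar> \<le> c"
  shows "bounded T"
proof -
  have "subspace {d. \<exists>c. \<forall>\<xi>\<in>T. \<bar>\<xi> \<bullet> d\<bar> \<le> c}"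
  proof (rule subspaceI)
    show "0 \<in> {d. \<exists>c. \<forall>\<xi>\<in>T. \<bar>\<xi> \<bullet> d\<bar> \<le> c}" by auto
  next
    fix d d' assume "d \<in> {d. \<exists>c. \<forall>\<xi>\<in>T. \<bar>\<xi> \<bullet> d\<bar> \<le> c}" "d' \<in> {d. \<exists>c. \<forall>\<xi>\<in>T. \<bar>\<xi> \<bullet> d\<bar> \<le> c}"
    then obtain c c' where c: "\<And>\<xi>. \<xi> \<in> T \<Longrightarrow> \<bar>\<xi> \<bullet> d\<bar> \<le> c" "\<And>\<xi>. \<xi> \<in> T \<Longrightarrow> \<bar>\<xi> \<bullet> d'\<bar> \<le> c'" by blast
    have "\<bar>\<xi> \<bullet> (d + d')\<bar> \<le> c + c'" if "\<xi> \<in> T" for \<xi>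
      using c[OF that] unfolding inner_add_right by linarith
    then show "d + d' \<in> {d. \<exists>c. \<forall>\<xi>\<in>T. \<bar>\<xi> \<bullet> d\<bar> \<le> c}" by blast
  next
    fix r :: real and d assume "d \<in> {d. \<exists>c. \<forall>\<xi>\<in>T. \<bar>\<xi> \<bullet> d\<bar> \<le> c}"
    then obtain c where c: "\<And>\<xi>. \<xi> \<in> T \<Longrightarrow> \<bar>\<xi> \<bullet> d\<bar> \<le> c" by blast
    have "\<bar>\<xi> \<bullet> (r *\<^sub>R d)\<bar> \<le> \<bar>r\<bar> * c" if "\<xi> \<in> T" for \<xi>
      using c[OF that] by (simp add: abs_mult mult_left_mono)
    then show "r *\<^sub>R d \<in> {d. \<exists>c. \<forall>\<xi>\<in>T. \<bar>\<xi> \<bullet> d\<bar> \<le> c}" by blast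
  qed
  moreover have "D \<subseteq> {d. \<exists>c. \<forall>\<xi>\<in>T. \<bar>\<xi> \<bullet> d\<bar> \<le> c}" using D by blast
  ultimately have all: "V \<subseteq> {d. \<exists>c. \<forall>\<xi>\<in>T. \<bar>\<xi> \<bullet> d\<bar> \<le> c}" unfolding V(1) by (rule span_minimal[rotated])
  have "\<exists>c. \<forall>\<xi>\<in>T. \<bar>\<xi> \<bullet> e\<bar> \<le> c" for e
  proof -
    obtain u w where uw: "u \<in> span V" "\<And>v. v \<in> span V \<Longrightarrow> orthogonal w v" "e = u + w"
      using orthogonal_subspace_decomp_exists[of V e] by blast
    have "span V = V" using V(1) by (simp add: span_span)
    then obtain c where c: "\<forall>\<xi>\<in>T. \<bar>\<xi> \<bullet> u\<bar> \<le> c" using uw(1) all by blast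
    have "\<xi> \<bullet> e = \<xi> \<bullet> u" if "\<xi> \<in> T" for \<xi>
      using uw(2)[of \<xi>] that V(2) \<open>span V = V\<close> by (auto simp: uw(3) inner_add_right orthogonal_def inner_commute)
    then show ?thesis using c by auto
  qed
  then obtain c where c: "\<And>e \<xi>. \<xi> \<in> T \<Longrightarrow> \<bar>\<xi> \<bullet> e\<bar> \<le> c e" by metis
  have "norm \<xi> \<le> (\<Sum>e\<in>Basis. c e)" if "\<xi> \<in> T" for \<xi>
  proof -
    have "norm \<xi> \<le> (\<Sum>e\<in>Basis. \<bar>\<xi> \<bullet> e\<bar>)" by (rule norm_le_l1)
    also have "\<dots> \<le> (\<Sum>e\<in>Basis. c e)" by (intro sum_mono c[OF that])
    finally show ?thesis .
  qed
  then show ?thesis by (auto simp: bounded_iff)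
qed

lemma span_differences_base_change:
  fixes E :: "'a::real_vector set"
  assumes "y \<in> E" "z \<in> E"
  shows "span ((\<lambda>x. x - y) ` E) = span ((\<lambda>x. x - z) ` E)"
proof -
  have "span ((\<lambda>x. x - y) ` E) \<subseteq> span ((\<lambda>x. x - z) ` E)" if "y \<in> E" "z \<in> E" for y z
  proof (rule span_minimal)
    show "(\<lambda>x. x - y) ` E \<subseteq> span ((\<lambda>x. x - z) ` E)"
    proof
      fix d assume "d \<in> (\<lambda>x. x - y) ` E"
      then obtain x where x: "x \<in> E" "d = (x - z) - (y - z)" by auto
      show "d \<in> span ((\<lambda>x. x - z) ` E)"
        unfolding x(2) using x(1) that by (intro span_diff span_base) auto
    qed
  qed simp
  then show ?thesis using assms by blast
qed

text \<open>
  Orthogonal projection onto \<open>V\<close> changes no inner product with \<open>x - y\<close> and increases no distance.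
\<close>

lemma project_jets:
  assumes V: "subspace V" and S: "\<And>x y. x \<in> S \<Longrightarrow> y \<in> S \<Longrightarrow> x - y \<in> V"
    and \<omega>: "\<omega> \<in> jets f \<eta> M UNIV S"
  shows "jets f \<eta> M V S \<noteq> {}"
proof -
  have "\<exists>u. u \<in> V \<and> (\<forall>v\<in>V. (\<xi> - u) \<bullet> v = 0)" for \<xi> :: 'a
  proof -
    obtain u w where "u \<in> span V" "\<And>v. v \<in> span V \<Longrightarrow> orthogonal w v" "\<xi> = u + w"
      using orthogonal_subspace_decomp_exists[of V \<xi>] by blast
    moreover have "span V = V" using V by (simp add: span_eq_iff)
    ultimately show ?thesis by (intro exI[of _ u]) (auto simp: orthogonal_def)
  qed
  then obtain \<pi> where \<pi>: "\<And>\<xi>. \<pi> \<xi> \<in> V" "\<And>\<xi> v. v \<in> V \<Longrightarrow> (\<xi> - \<pi> \<xi>) \<bullet> v = 0" by metis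
  have "(\<lambda>x. \<pi> (\<omega> x)) \<in> jets f \<eta> M V S"
    unfolding jets_def
  proof (intro CollectI ballI conjI)
    fix x y assume x: "x \<in> S" and y: "y \<in> S"
    have "\<omega> y \<bullet> (x - y) = \<pi> (\<omega> y) \<bullet> (x - y)"
      using \<pi>(2)[OF S[OF x y], of "\<omega> y"] by (simp add: inner_diff_left)
    then show "f y + \<pi> (\<omega> y) \<bullet> (x - y) + \<eta> / 2 * (norm (x - y))\<^sup>2 \<le> f x"
      using jetsD(2)[OF \<omega> x y] by simp
    define d where "d = \<pi> (\<omega> x) - \<pi> (\<omega> y)"
    have "d \<in> V" unfolding d_def using \<pi>(1) V by (intro subspace_diff)
    then have "d \<bullet> d = (\<omega> x - \<omega> y) \<bullet> d"
      using \<pi>(2)[of d "\<omega> x"] \<pi>(2)[of d "\<omega> y"] by (simp add: d_def inner_diff_left)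
    then have "norm d * norm d \<le> norm (\<omega> x - \<omega> y) * norm d"
      using norm_cauchy_schwarz[of "\<omega> x - \<omega> y" d] by (simp add: dot_square_norm power2_eq_square)
    then have "norm d \<le> norm (\<omega> x - \<omega> y)"
      by (cases "d = 0") auto
    then show "norm (\<pi> (\<omega> x) - \<pi> (\<omega> y)) \<le> M * norm (x - y)"
      using jetsD(3)[OF \<omega> x y] by (simp add: d_def)
  qed (use \<pi> in auto)
  then show ?thesis by blast
qed

lemma convex_jet_fiber:
  assumes "subspace V"
  shows "convex (jet_fiber f \<eta> M V E c y)"
proof -
  have "jet_fiber f \<eta> M V E c y = V \<inter> (\<Inter>S\<in>{S. S \<subseteq> E \<and> finite S \<and> card S \<le> c \<and> y \<in> S}.
      (\<lambda>\<omega>. \<omega> y) ` {\<omega> \<in> jets f \<eta> M V S. \<omega> y \<in> UNIV})"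
    unfolding jet_fiber_def by (auto simp: image_iff Bex_def)
  moreover have "convex ((\<lambda>\<omega>. \<omega> y) ` {\<omega> \<in> jets f \<eta> M V S. \<omega> y \<in> UNIV})" for S
    using convex_jet_values[OF assms convex_UNIV] .
  ultimately show ?thesis
    using subspace_imp_convex[OF assms] by (simp only:) (intro convex_Int convex_INT)
qed

lemma bounded_jet_fiber:
  assumes "y \<in> E" "2 \<le> c" and V: "V = span ((\<lambda>x. x - y) ` E)" and pos: "0 \<le> \<eta>" "0 \<le> M"
  shows "bounded (jet_fiber f \<eta> M V E c y)"
proof (rule bounded_of_bounded_inner_span[OF V])
  show "jet_fiber f \<eta> M V E c y \<subseteq> V" by (auto simp: jet_fiber_def)
  fix d assume "d \<in> (\<lambda>x. x - y) ` E"
  then obtain x where x: "x \<in> E" "d = x - y" by blast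
  have "\<bar>\<xi> \<bullet> d\<bar> \<le> \<bar>f x - f y\<bar> + M * (norm (x - y))\<^sup>2" if \<xi>: "\<xi> \<in> jet_fiber f \<eta> M V E c y" for \<xi>
  proof -
    obtain \<omega> where "\<omega> \<in> jets f \<eta> M V {x, y}" "\<omega> y = \<xi>"
      using jet_fiber_pairs[OF \<xi> assms(2) x(1) assms(1)] by blast
    then show ?thesis using jet_inner_bound[of \<omega> f \<eta> M V "{x, y}" x y] pos x(2) by auto
  qed
  then show "\<exists>c'. \<forall>\<xi>\<in>jet_fiber f \<eta> M V E c y. \<bar>\<xi> \<bullet> d\<bar> \<le> c'" by blast
qed

text \<open>
  As in \<open>jet_fiber_transport\<close>, but no value is known beforehand. To have compact sets, all fields are
  considered on a fixed finite set \<open>S0\<close> as well, whose differences from \<open>y\<close> span \<open>V\<close>; then the value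
  at \<open>y\<close> is bounded.
\<close>

lemma jet_fiber_nonempty:
  fixes E :: "'a::euclidean_space set"
  assumes y: "y \<in> E" and c: "2 \<le> c" and V: "V = span ((\<lambda>x. x - y) ` E)" and pos: "0 \<le> \<eta>" "0 \<le> M"
    and ne: "\<And>S. S \<subseteq> E \<Longrightarrow> finite S \<Longrightarrow> card S \<le> (DIM('a) + 1) * (c + 1) + 2 \<Longrightarrow> jets f \<eta> M V S \<noteq> {}"
  shows "jet_fiber f \<eta> M V E c y \<noteq> {}"
proof -
  have Vsub: "subspace V" unfolding V by simp
  obtain B where B: "B \<subseteq> (\<lambda>x. x - y) ` E" "independent B" "(\<lambda>x. x - y) ` E \<subseteq> span B"
    using maximal_independent_subset by blast
  have Bfin: "finite B" "card B \<le> DIM('a)" using independent_bound[OF B(2)] by auto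
  have "V \<subseteq> span B" unfolding V using B(3) by (intro span_minimal) auto
  moreover have "span B \<subseteq> V" unfolding V using B(1) by (rule span_mono)
  ultimately have VB: "V = span B" by blast
  define S0 where "S0 = insert y ((\<lambda>d. d + y) ` B)"
  have S0: "S0 \<subseteq> E" "finite S0" "y \<in> S0" using B(1) Bfin y by (auto simp: S0_def)
  have S0card: "card S0 \<le> DIM('a) + 1"
    unfolding S0_def using card_image_le[OF Bfin(1), of "\<lambda>d. d + y"] Bfin(2) by (intro card_insert_le_m1) auto
  define T0 where "T0 = (\<lambda>\<omega>. \<omega> y) ` jets f \<eta> M V S0"
  have "bounded T0"
  proof (rule bounded_of_bounded_inner_span[OF VB])
    show "T0 \<subseteq> V" using jetsD(1)[OF _ S0(3)] by (auto simp: T0_def)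
    fix d assume "d \<in> B"
    then have dS: "d + y \<in> S0" by (simp add: S0_def)
    have "\<bar>\<xi> \<bullet> d\<bar> \<le> \<bar>f (d + y) - f y\<bar> + M * (norm d)\<^sup>2" if \<xi>: "\<xi> \<in> T0" for \<xi>
    proof -
      obtain \<omega> where "\<omega> \<in> jets f \<eta> M V S0" "\<xi> = \<omega> y" using \<xi> by (auto simp: T0_def)
      then show ?thesis using jet_inner_bound[OF _ dS S0(3) pos, of \<omega> f V] by simp
    qed
    then show "\<exists>c. \<forall>\<xi>\<in>T0. \<bar>\<xi> \<bullet> d\<bar> \<le> c" by blast
  qed
  then obtain R where R: "\<And>\<xi>. \<xi> \<in> T0 \<Longrightarrow> norm \<xi> \<le> R" by (auto simp: bounded_iff)
  define I where "I = {S. S \<subseteq> E \<and> finite S \<and> card S \<le> c \<and> y \<in> S}"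
  define T where "T S = (\<lambda>\<omega>. \<omega> y) ` {\<omega> \<in> jets f \<eta> M V (S \<union> S0). \<omega> y \<in> cball 0 R}" for S
  have "\<Inter>(T ` I) \<noteq> {}"
  proof (rule Helly_compact_family)
    fix S assume S: "S \<in> I"
    show "compact (T S)" unfolding T_def
      using S by (intro compact_jet_values closed_subspace Vsub) (auto simp: I_def)
    show "convex (T S)" unfolding T_def by (intro convex_jet_values Vsub) auto
  next
    fix J assume J: "J \<subseteq> I" "finite J" "card J \<le> DIM('a) + 1"
    define U where "U = \<Union>J \<union> S0"
    have "card (\<Union>J) \<le> (\<Sum>S\<in>J. card S)" by (rule card_Union_le_sum_card)
    also have "\<dots> \<le> card J * c"
      using sum_bounded_above[of J card c] J(1) by (auto simp: I_def)
    also have "\<dots> \<le> (DIM('a) + 1) * c" using J(3) by (rule mult_right_mono) simp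
    finally have "card U \<le> (DIM('a) + 1) * c + (DIM('a) + 1)"
      unfolding U_def using card_Un_le[of "\<Union>J" S0] S0card by linarith
    also have "\<dots> \<le> (DIM('a) + 1) * (c + 1) + 2" by simp
    finally have Uc: "card U \<le> (DIM('a) + 1) * (c + 1) + 2" .
    have "finite U" "U \<subseteq> E" using J S0 by (auto simp: U_def I_def)
    then obtain \<omega> where \<omega>: "\<omega> \<in> jets f \<eta> M V U" using ne[OF _ _ Uc] by blast
    have "\<omega> \<in> jets f \<eta> M V S0" using \<omega> jets_antimono[of S0 U f \<eta> M V] by (auto simp: U_def)
    then have "\<omega> y \<in> cball 0 R" using R[of "\<omega> y"] by (simp add: T0_def)
    then have "\<omega> y \<in> T S" if "S \<in> J" for S
      unfolding T_def using \<omega> jets_antimono[of "S \<union> S0" U f \<eta> M V] that by (auto simp: U_def)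
    then show "\<Inter>(T ` J) \<noteq> {}" by blast
  qed
  then obtain \<zeta> where \<zeta>: "\<And>S. S \<in> I \<Longrightarrow> \<zeta> \<in> T S" by blast
  have fib: "\<exists>\<omega>\<in>jets f \<eta> M V S. \<omega> y = \<zeta>" if S: "S \<subseteq> E" "finite S" "card S \<le> c" "y \<in> S" for S
  proof -
    obtain \<omega> where "\<omega> \<in> jets f \<eta> M V (S \<union> S0)" "\<zeta> = \<omega> y"
      using \<zeta>[of S] S by (auto simp: I_def T_def)
    then show ?thesis using jets_antimono[of S "S \<union> S0" f \<eta> M V] by auto
  qed
  have "\<zeta> \<in> V" using fib[of "{y}"] y c jetsD(1)[of _ f \<eta> M V "{y}" y] by auto
  then have "\<zeta> \<in> jet_fiber f \<eta> M V E c y" using fib by (simp add: jet_fiber_def)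
  then show ?thesis by blast
qed

text \<open>
  The recursion is dictated by \<open>jet_fiber_transport\<close>.
\<close>

fun fiber_level :: "nat \<Rightarrow> nat \<Rightarrow> nat" where
  "fiber_level n 0 = 2"
| "fiber_level n (Suc j) = (n + 1) * (fiber_level n j + 1) + 2"

lemma fiber_level_ge_2: "2 \<le> fiber_level n j"
  by (cases j) auto

text \<open>
  The fibers of decreasing level form a chain, and at the last level, 2, a selection satisfies the
  inequality between any two points.
\<close>

theorem jets_finiteness_principle:
  "\<exists>(k::nat) C. 0 \<le> C \<and> (\<forall>(E::'a::euclidean_space set) f \<eta> M. E \<noteq> {} \<longrightarrow> 0 \<le> \<eta> \<longrightarrow> 0 < M \<longrightarrow>
     (\<forall>S\<subseteq>E. finite S \<and> card S \<le> k \<longrightarrow> jets f \<eta> M UNIV S \<noteq> {}) \<longrightarrow>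
     jets f \<eta> (C * M) UNIV E \<noteq> {})"
proof -
  obtain L C where sel: "lipschitz_selectable TYPE('a) DIM('a) L C"
    using lipschitz_selection_of_chain by blast
  define n where "n = DIM('a)"
  have main: "jets f \<eta> (C * M) UNIV E \<noteq> {}"
    if E: "E \<noteq> {}" and pos: "0 \<le> \<eta>" "0 < M"
      and ne: "\<forall>S\<subseteq>E. finite S \<and> card S \<le> fiber_level n (Suc L) \<longrightarrow> jets f \<eta> M UNIV S \<noteq> {}"
    for E :: "'a set" and f \<eta> M
  proof -
    obtain x0 where x0: "x0 \<in> E" using E by blast
    define V where "V = span ((\<lambda>x. x - x0) ` E)"
    have V: "subspace V" by (simp add: V_def)
    have Vy: "V = span ((\<lambda>x. x - y) ` E)" if "y \<in> E" for y
      unfolding V_def by (rule span_differences_base_change[OF x0 that])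
    have diffV: "x - y \<in> V" if "x \<in> E" "y \<in> E" for x y
      unfolding Vy[OF that(2)] using that(1) by (intro span_base) auto
    have neV: "jets f \<eta> M V S \<noteq> {}" if S: "S \<subseteq> E" "finite S" "card S \<le> fiber_level n (Suc L)" for S
    proof -
      obtain \<omega> where "\<omega> \<in> jets f \<eta> M UNIV S" using ne S by blast
      then show ?thesis using project_jets[OF V _ ] diffV S(1) by (meson subsetD)
    qed
    define \<Gamma> where "\<Gamma> i y = jet_fiber f \<eta> M V E (fiber_level n (L - i)) y" for i y
    have chain: "lipschitz_chain M L E \<Gamma>"
      unfolding lipschitz_chain_def
    proof (intro conjI allI impI ballI)
      show "convex (\<Gamma> i x)" for i x unfolding \<Gamma>_def by (rule convex_jet_fiber[OF V])
      show "bounded (\<Gamma> i x)" if "x \<in> E" for i x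
        unfolding \<Gamma>_def using that fiber_level_ge_2 Vy pos by (intro bounded_jet_fiber) auto
      show "\<Gamma> 0 x \<noteq> {}" if "x \<in> E" for x
        unfolding \<Gamma>_def using neV pos
        by (intro jet_fiber_nonempty[OF that fiber_level_ge_2 Vy[OF that]]) (auto simp: n_def)
      fix i x y \<xi> assume i: "i < L" and xy: "x \<in> E" "y \<in> E" and \<xi>: "\<xi> \<in> \<Gamma> i x"
      have "L - i = Suc (L - Suc i)" using i by simp
      then have "\<xi> \<in> jet_fiber f \<eta> M V E ((DIM('a) + 1) * (fiber_level n (L - Suc i) + 1) + 2) x"
        using \<xi> by (simp add: \<Gamma>_def n_def)
      then show "\<exists>\<zeta>\<in>\<Gamma> (Suc i) y. norm (\<zeta> - \<xi>) \<le> M * norm (x - y)"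
        unfolding \<Gamma>_def by (rule jet_fiber_transport[OF V xy])
    qed
    have "dim V \<le> DIM('a)" by (rule dim_subset_UNIV)
    moreover have "\<forall>i\<le>L. \<forall>x\<in>E. \<forall>\<xi>\<in>\<Gamma> i x. \<xi> - 0 \<in> V" by (simp add: \<Gamma>_def jet_fiber_def)
    ultimately obtain s where s: "\<And>x. x \<in> E \<Longrightarrow> s x \<in> \<Gamma> L x"
      "\<And>x y. x \<in> E \<Longrightarrow> y \<in> E \<Longrightarrow> norm (s x - s y) \<le> C * M * norm (x - y)"
      using sel chain V pos(2) unfolding lipschitz_selectable_def by metis
    have "f y + s y \<bullet> (x - y) + \<eta> / 2 * (norm (x - y))\<^sup>2 \<le> f x" if xy: "x \<in> E" "y \<in> E" for x y
    proof -
      have "s y \<in> jet_fiber f \<eta> M V E 2 y" using s(1)[OF xy(2)] by (simp add: \<Gamma>_def)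
      then obtain \<omega> where "\<omega> \<in> jets f \<eta> M V {x, y}" "\<omega> y = s y"
        using jet_fiber_pairs xy by blast
      then show ?thesis using jetsD(2)[of \<omega> f \<eta> M V "{x, y}" x y] by simp
    qed
    then have "s \<in> jets f \<eta> (C * M) UNIV E" using s(2) by (simp add: jets_def)
    then show ?thesis by blast
  qed
  have "0 \<le> C" using sel by (simp add: lipschitz_selectable_def)
  then show ?thesis using main by (intro exI[of _ "fiber_level n (Suc L)"] exI[of _ C]) blast
qed

section \<open>Finiteness principle for strongly convex functions\<close>

theorem theorem1:
  "\<exists>(k::nat) (C1::real). C1 > 0 \<and>
    (\<forall>(E :: (real ^ 'n) set) (M::real) (\<eta>::real) (f :: real ^ 'n \<Rightarrow> real).
      compact E \<longrightarrow> 0 < \<eta> \<longrightarrow> \<eta> < M \<longrightarrow>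
      (\<forall>S\<subseteq>E. finite S \<and> card S \<le> k \<longrightarrow>
        (\<exists>F\<in>C11c. strongly_convex \<eta> F \<and> (\<forall>x\<in>S. F x = f x) \<and> Lip (grad F) \<le> ereal M)) \<longrightarrow>
      (\<forall>(p::real) (q::real). p > 1 \<longrightarrow> q > 1 \<longrightarrow> 1 / p + 1 / q = 1 \<longrightarrow>
        (\<exists>F\<in>C11c. strongly_convex (\<eta> / p\<^sup>2) F \<and> (\<forall>x\<in>E. F x = f x) \<and>
          Lip (grad F) \<le> ereal (C1 * q\<^sup>2 * M\<^sup>2 / \<eta>))))"
proof -
  obtain k C where C: "0 \<le> C" and jets_ne: "\<forall>(E::(real ^ 'n) set) f \<eta> M. E \<noteq> {} \<longrightarrow> 0 \<le> \<eta> \<longrightarrow> 0 < M \<longrightarrow>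
     (\<forall>S\<subseteq>E. finite S \<and> card S \<le> k \<longrightarrow> jets f \<eta> M UNIV S \<noteq> {}) \<longrightarrow> jets f \<eta> (C * M) UNIV E \<noteq> {}"
    using jets_finiteness_principle by blast
  have main: "\<exists>F\<in>C11c. strongly_convex (\<eta> / p\<^sup>2) F \<and> (\<forall>x\<in>E. F x = f x) \<and>
      Lip (grad F) \<le> ereal (((C + 1)\<^sup>2 + 1) * q\<^sup>2 * M\<^sup>2 / \<eta>)"
    if E: "compact E" and \<eta>: "0 < \<eta>" "\<eta> < M" and pq: "p > 1" "q > 1" "1 / p + 1 / q = 1"
      and fin: "\<forall>S\<subseteq>E. finite S \<and> card S \<le> k \<longrightarrow>
        (\<exists>F\<in>C11c. strongly_convex \<eta> F \<and> (\<forall>x\<in>S. F x = f x) \<and> Lip (grad F) \<le> ereal M)"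
    for E :: "(real ^ 'n) set" and M \<eta> p q f
  proof -
    define \<mu> where "\<mu> = \<eta> / p\<^sup>2"
    \<comment> \<open>Chosen so that \<open>(C * M + \<mu>)\<^sup>2 \<le> L * (\<eta> - \<mu>)\<close>: the gap \<open>\<eta> - \<mu>\<close> is at least \<open>\<eta> / q\<close> and \<open>\<mu> \<le> M\<close>.\<close>
    define L where "L = (C + 1)\<^sup>2 * M\<^sup>2 * q / \<eta>"
    have p2: "p \<le> p\<^sup>2" using pq(1) by (simp add: power2_eq_square)
    have q2: "q \<le> q\<^sup>2" "1 \<le> q\<^sup>2" using pq(2) by (auto simp: power2_eq_square mult_ge1_I)
    have \<mu>: "0 \<le> \<mu>" "\<mu> \<le> \<eta>" using \<eta> p2 pq(1) by (auto simp: \<mu>_def divide_le_eq)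
    have gap: "\<eta> / q \<le> \<eta> - \<mu>"
    proof -
      have "\<mu> \<le> \<eta> / p" unfolding \<mu>_def using p2 pq(1) \<eta> by (intro divide_left_mono) auto
      moreover have "\<eta> / p + \<eta> / q = \<eta>"
        using arg_cong[OF pq(3), of "\<lambda>t. \<eta> * t"] by (simp add: distrib_left)
      ultimately show ?thesis by linarith
    qed
    have L0: "0 < L" using C \<eta> pq(2) by (simp add: L_def)
    have KL: "(C * M + \<mu>)\<^sup>2 \<le> L * (\<eta> - \<mu>)"
    proof -
      have "(C * M + \<mu>)\<^sup>2 \<le> ((C + 1) * M)\<^sup>2"
        using C \<eta> \<mu> by (intro power_mono) (auto simp: algebra_simps)
      also have "\<dots> = L * (\<eta> / q)" using \<eta> pq(2) by (simp add: L_def power_mult_distrib)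
      also have "\<dots> \<le> L * (\<eta> - \<mu>)" using gap L0 by (intro mult_left_mono) auto
      finally show ?thesis .
    qed
    have bound: "L + \<mu> \<le> ((C + 1)\<^sup>2 + 1) * q\<^sup>2 * M\<^sup>2 / \<eta>"
    proof -
      have "L \<le> (C + 1)\<^sup>2 * M\<^sup>2 * q\<^sup>2 / \<eta>"
        unfolding L_def using q2 \<eta> by (intro divide_right_mono mult_left_mono) auto
      moreover have "\<mu> \<le> q\<^sup>2 * M\<^sup>2 / \<eta>"
      proof -
        have "\<mu> * \<eta> \<le> M * M" using \<mu> \<eta> by (intro mult_mono) auto
        also have "\<dots> \<le> q\<^sup>2 * M\<^sup>2" using mult_right_mono[OF q2(2), of "M\<^sup>2"] by (simp add: power2_eq_square)
        finally show ?thesis using \<eta> by (simp add: le_divide_eq)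
      qed
      moreover have "((C + 1)\<^sup>2 + 1) * q\<^sup>2 * M\<^sup>2 / \<eta> = (C + 1)\<^sup>2 * M\<^sup>2 * q\<^sup>2 / \<eta> + q\<^sup>2 * M\<^sup>2 / \<eta>"
        unfolding add_divide_distrib[symmetric] by (simp add: algebra_simps)
      ultimately show ?thesis by linarith
    qed
    have ext: "\<exists>F\<in>C11c. strongly_convex (\<eta> / p\<^sup>2) F \<and> (\<forall>x\<in>E. F x = f x) \<and>
        Lip (grad F) \<le> ereal (((C + 1)\<^sup>2 + 1) * q\<^sup>2 * M\<^sup>2 / \<eta>)"
      if E: "E \<noteq> {}" "bounded E" and \<xi>: "\<xi> \<in> jets f \<eta> (C * M) UNIV E" for E :: "(real ^ 'n) set" and f \<xi>
    proof -
      obtain F where "F \<in> C11c" "strongly_convex \<mu> F" "\<forall>x\<in>E. F x = f x" "Lip (grad F) \<le> ereal (L + \<mu>)"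
        using strongly_convex_extension_of_jets[OF E \<mu>(1) _ L0 KL, of \<xi> f] jetsD(2,3)[OF \<xi>] C \<eta> by auto
      then show ?thesis using bound unfolding \<mu>_def by (meson ereal_less_eq(3) order_trans)
    qed
    show ?thesis
    proof (cases "E = {}")
      case True
      \<comment> \<open>Some interpolation point is needed to have a supremum of affine functions; the origin serves.\<close>
      have "(\<lambda>_. 0) \<in> jets (\<lambda>_. 0) \<eta> (C * M) UNIV {0::real ^ 'n}" by (simp add: jets_def)
      from ext[OF _ _ this] show ?thesis using True by auto
    next
      case False
      have "jets f \<eta> M UNIV S \<noteq> {}" if S: "S \<subseteq> E" "finite S" "card S \<le> k" for S
      proof -
        obtain F where F: "F \<in> C11c" "strongly_convex \<eta> F" "\<forall>x\<in>S. F x = f x" "Lip (grad F) \<le> ereal M"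
          using fin S by blast
        have "0 \<le> M" using \<eta> by simp
        note F_jets = C11c_jets[OF F(1,2) this F(4)]
        have "grad F \<in> jets f \<eta> M UNIV S"
          unfolding jets_def
        proof (intro CollectI ballI conjI)
          fix x y assume "x \<in> S" "y \<in> S"
          then show "f y + grad F y \<bullet> (x - y) + \<eta> / 2 * (norm (x - y))\<^sup>2 \<le> f x"
            using F_jets(1)[of y x] F(3) by simp
        qed (use F_jets(2) in auto)
        then show ?thesis by blast
      qed
      then obtain \<xi> where "\<xi> \<in> jets f \<eta> (C * M) UNIV E"
        using jets_ne[rule_format, of E \<eta> M f] False \<eta> by auto
      then show ?thesis using ext False compact_imp_bounded[OF E] by blast
    qed
  qed
  show ?thesis
  proof (intro exI[of _ k] exI[of _ "(C + 1)\<^sup>2 + 1"] conjI allI impI)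
    show "0 < (C + 1)\<^sup>2 + 1" using zero_le_power2[of "C + 1"] by linarith
  qed (rule main)
qed

end
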